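(* Given a sequence of points $x_n\searrow0$ in $[0,1]$ and positive weights $p(n)\searrow0$ with $\sum_{n=1}^\infty p(n)<\infty$ ($n\in\mathbb{N}=\{1,2,\dots\}$), let \[ \mu=\frac{1}{\sum_{n=1}^\infty p(n)}\sum_{n=1}^\infty p(n)\,\delta_{x_n}, \] where $\delta_{x_n}$ is the unit point mass at $x_n$. (1) Polynomial-polynomial: let $\lambda>0$ and $\omega>1$ and suppose $x_n=n^{-\lambda}$ and $p(n)=n^{-\omega}$. Then \[ \overline{\dim}_{\mathrm{reg}}\,\mu=\max\left\{1,\frac{\omega-1}{\lambda}\right\}=\max\left\{\dim_{\mathrm{A}}\mathrm{supp}(\mu),\ \sup_{x\in\mathrm{supp}(\mu)}\overline{\dim}_{\mathrm{loc}}(x,\mu)\right\}. \] (2) Exponential-exponential: let $\lambda,\omega\in(0,1)$ and suppose $x_n=\lambda^n$ and $p(n)=\omega^n$. Then \[ \overline{\dim}_{\mathrm{reg}}\,\mu=\frac{\log\omega}{\log\lambda}=\sup_{x\in\mathrm{supp}(\mu)}\overline{\dim}_{\mathrm{loc}}(x,\mu)\ >\ 0=\dim_{\mathrm{A}}\mathrm{supp}(\mu). \] (3) Mixed rates: if either (i) $x_n=n^{-\lambda}$ with $\lambda>0$ and $p(n)=\omega^n$ with $0<\omega<1$, or (ii) $x_n=\lambda^n$ with $0<\lambda<1$ and $p(n)=n^{-\omega}$ with $\omega>1$, then $\mu$ is not doubling, and so $\overline{\dim}_{\mathrm{reg}}\,\mu=\infty$.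
   Context: $B(x,r)$ denotes the open ball of centre $x$ and radius $r$, and $\mathrm{supp}(\mu)$ is the (closed) support of $\mu$. Upper regularity dimension: $\overline{\dim}_{\mathrm{reg}}\,\mu$ is the infimum of all $s\ge 0$ for which there is a constant $C>0$ such that for all $0<r<R$ and all $x\in\mathrm{supp}(\mu)$, $\frac{\mu(B(x,R))}{\mu(B(x,r))}\le C\left(\frac{R}{r}\right)^s$ (with $\inf\emptyset=+\infty$). Upper local dimension at $x\in\mathrm{supp}(\mu)$: $\overline{\dim}_{\mathrm{loc}}(x,\mu)=\limsup_{r\to0}\frac{\log\mu(B(x,r))}{\log r}$. $\mu$ is doubling if there is a constant $0<C<\infty$ such that $\frac{\mu(B(x,R))}{\mu(B(x,R/2))}\le C$ for all $R>0$ and all $x\in\mathrm{supp}(\mu)$. $\dim_{\mathrm{A}}F$ denotes the Assouad dimension of a set $F$: the infimum of all $s\ge0$ for which there is $C>0$ such that for all $0<r<R$ and $x\in F$, the set $B(x,R)\cap F$ can be covered by at most $C(R/r)^s$ balls of radius $r$. *)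

theory Defs
  imports "HOL-Probability.Probability"
begin

text \<open>
  The notions for measures below are meant for finite Borel measures on a metric space. They use the
  real-valued \<^const>\<open>measure\<close>, which is \<open>0\<close> on sets of infinite measure and so would be wrong for
  infinite measures. Dimensions are extended reals.
\<close>

definition measure_support :: "'a::topological_space measure \<Rightarrow> 'a set" where
  "measure_support M = {x. \<forall>U. open U \<longrightarrow> x \<in> U \<longrightarrow> emeasure M U > 0}"

text \<open>In \<^typ>\<open>ereal\<close> the infimum of the empty set is \<open>\<infinity>\<close>.\<close>

definition upper_reg_dim :: "'a::metric_space measure \<Rightarrow> ereal" where
  "upper_reg_dim M = Inf {ereal s | s. s \<ge> 0 \<and>
     (\<exists>C>0. \<forall>r R. 0 < r \<longrightarrow> r < R \<longrightarrow> (\<forall>x\<in>measure_support M.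
        measure M (ball x R) / measure M (ball x r) \<le> C * (R / r) powr s))}"

definition upper_local_dim :: "'a::metric_space \<Rightarrow> 'a measure \<Rightarrow> ereal" where
  "upper_local_dim x M =
     Limsup (at_right 0) (\<lambda>r. ereal (ln (measure M (ball x r)) / ln r))"

definition doubling_measure :: "'a::metric_space measure \<Rightarrow> bool" where
  "doubling_measure M \<longleftrightarrow>
     (\<exists>C>0. \<forall>R>0. \<forall>x\<in>measure_support M. measure M (ball x R) / measure M (ball x (R / 2)) \<le> C)"

text \<open>The centres of the covering balls are arbitrary points of the ambient space.\<close>

definition assouad_dim :: "'a::metric_space set \<Rightarrow> ereal" where
  "assouad_dim F = Inf {ereal s | s. s \<ge> 0 \<and>
     (\<exists>C>0. \<forall>r R. 0 < r \<longrightarrow> r < R \<longrightarrow> (\<forall>x\<in>F.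
        \<exists>T. finite T \<and> real (card T) \<le> C * (R / r) powr s \<and>
            ball x R \<inter> F \<subseteq> (\<Union>t\<in>T. ball t r)))}"

text \<open>
  Sequences are indexed by \<open>n \<ge> 1\<close>, hence the shift by \<^const>\<open>Suc\<close>; the values of \<open>x\<close> and \<open>p\<close> at \<open>0\<close>
  are irrelevant.
\<close>

definition weighted_point_masses :: "(nat \<Rightarrow> real) \<Rightarrow> (nat \<Rightarrow> real) \<Rightarrow> real measure" where
  "weighted_point_masses x p = measure_of UNIV (sets borel)
     (\<lambda>A. \<Sum>n. ennreal (p (Suc n)) * emeasure (return borel (x (Suc n))) A)"

definition normalized_point_masses :: "(nat \<Rightarrow> real) \<Rightarrow> (nat \<Rightarrow> real) \<Rightarrow> real measure" where
  "normalized_point_masses x p =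
     scale_measure (ennreal (1 / (\<Sum>n. p (Suc n)))) (weighted_point_masses x p)"

lemma space_weighted_point_masses [simp]: "space (weighted_point_masses x p) = UNIV"
  by (simp add: weighted_point_masses_def space_measure_of_conv)

lemma sets_weighted_point_masses [simp, measurable_cong]:
  "sets (weighted_point_masses x p) = sets borel"
  unfolding weighted_point_masses_def
  by (metis sets.sets_measure_of_eq space_borel)

lemma emeasure_weighted_point_masses:
  assumes "A \<in> sets borel"
  shows "emeasure (weighted_point_masses x p) A =
           (\<Sum>n. ennreal (p (Suc n)) * indicator A (x (Suc n)))"
proof -
  let ?f = "\<lambda>A. \<Sum>n. ennreal (p (Suc n)) * emeasure (return borel (x (Suc n))) A"
  have "emeasure (weighted_point_masses x p) A = ?f A"
  proof (rule emeasure_measure_of[OF weighted_point_masses_def])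
    show "positive (sets (weighted_point_masses x p)) ?f"
      by (simp add: positive_def)
    show "countably_additive (sets (weighted_point_masses x p)) ?f"
    proof (rule countably_additiveI)
      fix B :: "nat \<Rightarrow> real set"
      assume B: "range B \<subseteq> sets (weighted_point_masses x p)" "disjoint_family B"
      have "(\<Sum>i. ?f (B i)) =
          (\<Sum>n. \<Sum>i. ennreal (p (Suc n)) * emeasure (return borel (x (Suc n))) (B i))"
        using nn_integral_suminf[of "\<lambda>i n. ennreal (p (Suc n)) * emeasure (return borel (x (Suc n))) (B i)"
            "count_space UNIV"]
        by (simp only: nn_integral_count_space_nat) (simp del: emeasure_return)
      also have "\<dots> = ?f (\<Union>i. B i)"
        using B by (simp add: suminf_emeasure del: emeasure_return)
      finally show "(\<Sum>i. ?f (B i)) = ?f (\<Union>i. B i)" .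
    qed
  qed (use assms in auto)
  then show ?thesis
    using assms by simp
qed

lemma sets_normalized_point_masses [simp, measurable_cong]:
  "sets (normalized_point_masses x p) = sets borel"
  by (simp add: normalized_point_masses_def)

lemma emeasure_normalized_point_masses:
  assumes "A \<in> sets borel"
  shows "emeasure (normalized_point_masses x p) A =
           ennreal (1 / (\<Sum>n. p (Suc n))) * (\<Sum>n. ennreal (p (Suc n)) * indicator A (x (Suc n)))"
  using assms by (simp add: normalized_point_masses_def emeasure_weighted_point_masses)

lemma prob_space_normalized_point_masses:
  assumes "\<And>n. n \<ge> 1 \<Longrightarrow> p n > 0" "summable (\<lambda>n. p (Suc n))"
  shows "prob_space (normalized_point_masses x p)"
proof
  have pos: "(\<Sum>n. p (Suc n)) > 0"
    using assms by (intro suminf_pos) auto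
  have "(\<Sum>n. ennreal (p (Suc n))) = ennreal (\<Sum>n. p (Suc n))"
    using assms by (intro suminf_ennreal2) (auto simp: less_imp_le)
  moreover have "space (normalized_point_masses x p) = UNIV"
    by (simp add: normalized_point_masses_def space_scale_measure)
  ultimately show "emeasure (normalized_point_masses x p) (space (normalized_point_masses x p)) = 1"
    using pos by (simp add: emeasure_normalized_point_masses flip: ennreal_mult)
qed

end

theory Submission
  imports Defs
begin

text \<open>
  The support of \<open>\<mu>\<close> is the sequence together with its limit \<open>0\<close>, and the measure of a ball is the sum
  of the weights of the indices whose points it contains. Everything follows from estimates of such
  sums that are sharp up to constant factors.

  Polynomial positions and weights, \<open>x n = n powr -l\<close> and \<open>p n = n powr -w\<close>. At the origin the mass of a
  ball of radius \<open>r \<le> 1\<close> is comparable to \<open>r powr t\<close> with \<open>t = (w - 1) / l\<close>. Around \<open>x n\<close> the points have spacing about \<open>x n / n\<close>; as the radius grows, the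
  mass is first that of one atom, then, from the spacing up to \<open>x n\<close>, it grows linearly (lemmas
  \<open>mass_near_atom_ge\<close> and \<open>mass_near_atom_le\<close>), and beyond \<open>x n\<close> it follows the power law of the origin
  (lemmas \<open>mass_near_origin_ge\<close> and \<open>mass_near_origin_le\<close>). The three regimes have the exponents \<open>0\<close>, \<open>1\<close>
  and \<open>t\<close>, and both \<open>1\<close> and \<open>t\<close> are attained over ranges of radii with unbounded ratio, so
  the upper regularity dimension is \<open>max 1 t\<close>. Here \<open>1\<close> is the Assouad dimension, seen on the block
  \<open>x n, \<dots>, x (2 * n)\<close>, and \<open>t\<close> is the local dimension at the origin, the local dimension at atoms
  being \<open>0\<close>.

  Geometric positions and weights, \<open>x n = l ^ n\<close> and \<open>p n = w ^ n\<close>. Now the spacing near \<open>x n\<close> is proportional to \<open>x n\<close>, so the linear regime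
  disappears and only the power law at the origin remains, with \<open>t = ln w / ln l\<close>. The points above any scale
  are logarithmically few, whence the Assouad dimension \<open>0\<close>.

  Mixed rates. If the positions are polynomial, halving the radius at the origin multiplies the first
  index by a fixed factor, and geometric weights turn this into an unbounded ratio of masses. If the positions are
  geometric, \<open>x n\<close> is isolated at its own scale, but its polynomial weight is negligible against the
  mass of the points below it. In both cases the measure is not doubling, and a finite upper
  regularity dimension would imply doubling.
\<close>

section \<open>Elementary estimates\<close>

text \<open>
  The mean value theorem for \<open>z\<close> to the power \<open>-s\<close>. With \<open>s = l\<close> it gives the spacing of the points
  \<open>n powr -l\<close>; with \<open>s = w - 1\<close> it turns the tail sums of \<open>n powr -w\<close> into telescoping ones.
\<close>

lemma powr_minus_diff_bounds:
  fixes a b s :: real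
  assumes "0 < a" "a \<le> b" "0 < s"
  shows "s * b powr (-s - 1) * (b - a) \<le> a powr -s - b powr -s"
    and "a powr -s - b powr -s \<le> s * a powr (-s - 1) * (b - a)"
proof -
  have "\<exists>z. a \<le> z \<and> z \<le> b \<and> a powr -s - b powr -s = s * z powr (-s - 1) * (b - a)"
  proof (cases "a = b")
    case False
    with assms have "a < b" by simp
    have "\<exists>z>a. z < b \<and> b powr -s - a powr -s = (b - a) * (-s * z powr (-s - 1))"
    proof (rule MVT2[OF \<open>a < b\<close>])
      fix z assume "a \<le> z" "z \<le> b"
      then show "DERIV (\<lambda>z. z powr -s) z :> -s * z powr (-s - 1)"
        using assms by (auto intro!: derivative_eq_intros simp: powr_diff)
    qed
    then show ?thesis
      by (smt (verit) mult.commute mult_minus_left)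
  qed auto
  then obtain z where z: "a \<le> z" "z \<le> b"
    and eq: "a powr -s - b powr -s = s * z powr (-s - 1) * (b - a)" by blast
  have "b powr (-s - 1) \<le> z powr (-s - 1)" "z powr (-s - 1) \<le> a powr (-s - 1)"
    using z assms by (auto intro: powr_mono2')
  then show "s * b powr (-s - 1) * (b - a) \<le> a powr -s - b powr -s"
    and "a powr -s - b powr -s \<le> s * a powr (-s - 1) * (b - a)"
    unfolding eq using assms by (auto intro!: mult_right_mono mult_left_mono)
qed

text \<open>
  The sharp lower bounds for dimensions below come from testing the defining inequality along a sequence of
  pairs \<open>r\<close>, \<open>R\<close> whose ratio grows like \<open>n\<close>, and then comparing exponents.
\<close>

lemma powr_growth_le_imp_exponent_le:
  fixes a s C :: real
  assumes "\<And>n::nat. n \<ge> 2 \<Longrightarrow> real n powr a \<le> C * real n powr s"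
  shows "a \<le> s"
proof (rule ccontr)
  assume "\<not> a \<le> s"
  then have d: "a - s > 0" by simp
  obtain n :: nat where n: "real n > max 2 ((\<bar>C\<bar> + 1) powr (1 / (a - s)))"
    using reals_Archimedean2 by blast
  have "\<bar>C\<bar> + 1 = ((\<bar>C\<bar> + 1) powr (1 / (a - s))) powr (a - s)"
    using d by (simp add: powr_powr)
  also have "\<dots> \<le> real n powr (a - s)"
    using n d by (intro powr_mono2) auto
  also have "\<dots> \<le> C"
    using assms[of n] n by (simp add: powr_diff divide_le_eq)
  finally show False by simp
qed

lemma card_nats_in_real_interval:
  fixes a b :: real
  assumes "a \<le> b"
  shows "finite {k::nat. a \<le> real k \<and> real k \<le> b}"
    and "real (card {k::nat. a \<le> real k \<and> real k \<le> b}) \<le> b - a + 1"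
proof -
  let ?K = "{k::nat. a \<le> real k \<and> real k \<le> b}"
  have sub: "int ` ?K \<subseteq> {\<lceil>a\<rceil>..\<lfloor>b\<rfloor>}"
    by (auto simp: le_floor_iff ceiling_le_iff)
  have inj: "inj_on int ?K" by simp
  show "finite ?K"
    using sub inj by (meson finite_atLeastAtMost_int finite_imageD finite_subset)
  have "card ?K = card (int ` ?K)" by (simp add: card_image)
  also have "\<dots> \<le> nat (\<lfloor>b\<rfloor> - \<lceil>a\<rceil> + 1)"
    using card_mono[OF _ sub] by simp
  finally have "real (card ?K) \<le> real (nat (\<lfloor>b\<rfloor> - \<lceil>a\<rceil> + 1))" by simp
  also have "\<dots> \<le> b - a + 1"
    using assms by linarith
  finally show "real (card ?K) \<le> b - a + 1" .
qed

lemma powr_minus_less_iff: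
  fixes a b s :: real
  assumes "0 < a" "0 < b" "0 < s"
  shows "a powr -s < b powr -s \<longleftrightarrow> b < a"
  using assms powr_less_mono2_neg[of "-s" b a] powr_mono2'[of "-s" a b] by force

text \<open>
  On a block starting at \<open>n\<close> and ending by \<open>2 * n\<close> the weights agree up to the factor \<open>2 powr w\<close>.
\<close>

lemma block_sum_powr_ge:
  assumes "n \<ge> 1" "m \<le> n" "w \<ge> 0"
  shows "real (m + 1) * (2 powr -w * real n powr -w) \<le> (\<Sum>k\<in>{n..n + m}. real k powr -w)"
proof -
  have "real (m + 1) * (2 powr -w * real n powr -w) = (\<Sum>k\<in>{n..n + m}. (2 * real n) powr -w)"
    by (simp add: powr_mult)
  also have "\<dots> \<le> (\<Sum>k\<in>{n..n + m}. real k powr -w)"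
    using assms by (intro sum_mono powr_mono2') auto
  finally show ?thesis .
qed

lemma infsum_geometric_tail:
  fixes w :: real
  assumes "0 < w" "w < 1"
  shows "infsum (\<lambda>k. w ^ k) {N..} = w ^ N / (1 - w)"
proof -
  have "(\<lambda>i. w ^ N * w ^ i) sums (w ^ N * (1 / (1 - w)))"
    using assms by (intro sums_mult geometric_sums) auto
  then have "((\<lambda>i. w ^ (N + i)) has_sum (w ^ N / (1 - w))) UNIV"
    using assms by (intro sums_nonneg_imp_has_sum) (auto simp: power_add)
  then have "((\<lambda>k. w ^ k) has_sum (w ^ N / (1 - w))) ((+) N ` UNIV)"
    by (subst has_sum_reindex) (auto simp: o_def)
  moreover have "(+) N ` UNIV = {N..}"
    by (auto simp: image_iff le_iff_add)
  ultimately show ?thesis by (simp add: infsumI)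
qed

section \<open>Bounding the dimensions\<close>

lemma upper_reg_dim_leI:
  assumes "s \<ge> 0" "C > 0"
    and "\<And>r R y. 0 < r \<Longrightarrow> r < R \<Longrightarrow> y \<in> measure_support M \<Longrightarrow>
           measure M (ball y R) \<le> C * (R / r) powr s * measure M (ball y r)"
  shows "upper_reg_dim M \<le> ereal s"
proof -
  have "measure M (ball y R) / measure M (ball y r) \<le> C * (R / r) powr s"
    if "0 < r" "r < R" "y \<in> measure_support M" for r R y
    using assms(3)[OF that] assms(2)
    by (cases "measure M (ball y r) = 0") (simp_all add: divide_le_eq less_le)
  then show ?thesis
    unfolding upper_reg_dim_def using assms(1,2) by (intro Inf_lower) blast
qed

lemma upper_reg_dim_geI:
  assumes "\<And>s C. s \<ge> 0 \<Longrightarrow> C > 0 \<Longrightarrow>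
    (\<And>r R y. 0 < r \<Longrightarrow> r < R \<Longrightarrow> y \<in> measure_support M \<Longrightarrow>
       measure M (ball y R) / measure M (ball y r) \<le> C * (R / r) powr s) \<Longrightarrow> a \<le> s"
  shows "ereal a \<le> upper_reg_dim M"
  unfolding upper_reg_dim_def using assms by (intro Inf_greatest) force

text \<open>
  The pair \<open>R / 2\<close>, \<open>R\<close> in the definition of the upper regularity dimension is the doubling condition
  with constant \<open>C * 2 powr s\<close>; a measure that is not doubling therefore admits no exponent at all.
\<close>

lemma upper_reg_dim_eq_infinity:
  assumes "\<not> doubling_measure M"
  shows "upper_reg_dim M = \<infinity>"
proof -
  have "doubling_measure M" if "C > 0" and
    H: "\<forall>r R. 0 < r \<longrightarrow> r < R \<longrightarrow> (\<forall>y\<in>measure_support M.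
        measure M (ball y R) / measure M (ball y r) \<le> C * (R / r) powr s)" for s C
    unfolding doubling_measure_def
  proof (intro exI conjI allI impI ballI)
    show "C * 2 powr s > 0" using that by simp
    fix R :: real and y assume "R > 0" "y \<in> measure_support M"
    then show "measure M (ball y R) / measure M (ball y (R / 2)) \<le> C * 2 powr s"
      using H[rule_format, of "R/2" R y] by simp
  qed
  then have "{ereal s | s. s \<ge> 0 \<and> (\<exists>C>0. \<forall>r R. 0 < r \<longrightarrow> r < R \<longrightarrow> (\<forall>y\<in>measure_support M.
        measure M (ball y R) / measure M (ball y r) \<le> C * (R / r) powr s))} = {}"
    using assms by blast
  then show ?thesis
    unfolding upper_reg_dim_def by (simp only: Inf_empty top_ereal_def)
qed

lemma measure_ball_support_pos:
  fixes M :: "'a::metric_space measure"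
  assumes "finite_measure M" "y \<in> measure_support M" "0 < r"
  shows "measure M (ball y r) > 0"
  using assms by (auto simp: measure_support_def finite_measure.emeasure_eq_measure)

lemma measure_ball_le_iterated_doubling:
  fixes M :: "'a::metric_space measure" and C :: real
  assumes M: "finite_measure M" and "C > 0"
    and "\<And>R y. R > 0 \<Longrightarrow> y \<in> measure_support M \<Longrightarrow>
           measure M (ball y R) / measure M (ball y (R / 2)) \<le> C"
    and "R > 0" "y \<in> measure_support M"
  shows "measure M (ball y R) \<le> C ^ j * measure M (ball y (R / 2 ^ j))"
proof (induction j)
  case (Suc j)
  have "measure M (ball y (R / 2 ^ j)) \<le> C * measure M (ball y (R / 2 ^ j / 2))"
    using assms(3)[of "R / 2 ^ j" y] measure_ball_support_pos[OF M, of y "R / 2 ^ j / 2"] assms(4,5)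
    by (simp add: divide_le_eq)
  then have "C ^ j * measure M (ball y (R / 2 ^ j))
      \<le> C ^ j * (C * measure M (ball y (R / 2 ^ j / 2)))"
    using assms(2) by (intro mult_left_mono) auto
  with Suc show ?case by (simp add: mult_ac)
qed simp

text \<open>
  Multiplicative constants disappear in the quotient of logarithms. The case \<open>t = 0\<close> is that of an atom.
\<close>

lemma upper_local_dim_eqI:
  assumes "a > 0"
    and lower: "\<And>r. 0 < r \<Longrightarrow> r < 1 \<Longrightarrow> a * r powr t \<le> measure M (ball y r)"
    and upper: "\<And>r. 0 < r \<Longrightarrow> r < 1 \<Longrightarrow> measure M (ball y r) \<le> b * r powr t"
  shows "upper_local_dim y M = ereal t"
proof -
  have "0 < a * (1/2) powr t" using assms(1) by simp
  also have "\<dots> \<le> b * (1/2) powr t"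
    using lower[of "1/2"] upper[of "1/2"] by linarith
  finally have "b > 0" by (simp add: zero_less_mult_iff)
  have inf: "filterlim (\<lambda>r::real. ln r) at_infinity (at_right 0)"
    using ln_at_0 by (rule filterlim_at_bot_imp_at_infinity)
  have lim: "((\<lambda>r. t + ln q / ln r) \<longlongrightarrow> t) (at_right 0)" for q :: real
    using tendsto_add[OF tendsto_const tendsto_divide_0[OF tendsto_const inf], of t "ln q"]
    by simp
  have ev: "eventually (\<lambda>r::real. 0 < r \<and> r < 1) (at_right 0)"
    by (auto simp: eventually_at_right_field intro: exI[of _ 1])
  have "((\<lambda>r. ln (measure M (ball y r)) / ln r) \<longlongrightarrow> t) (at_right 0)"
  proof (rule tendsto_sandwich[OF _ _ lim[of b] lim[of a]])
    show "eventually (\<lambda>r. t + ln b / ln r \<le> ln (measure M (ball y r)) / ln r) (at_right 0)"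
      using ev
    proof eventually_elim
      case (elim r)
      have "0 < a * r powr t" using elim \<open>a > 0\<close> by simp
      then have "ln (measure M (ball y r)) \<le> ln (b * r powr t)"
        using lower[of r] upper[of r] elim by (subst ln_le_cancel_iff) auto
      also have "\<dots> = ln b + t * ln r" using \<open>b > 0\<close> elim by (simp add: ln_mult ln_powr)
      finally have "(ln b + t * ln r) / ln r \<le> ln (measure M (ball y r)) / ln r"
        using elim by (intro divide_right_mono_neg) auto
      then show ?case using elim by (simp add: add_divide_distrib add.commute)
    qed
    show "eventually (\<lambda>r. ln (measure M (ball y r)) / ln r \<le> t + ln a / ln r) (at_right 0)"
      using ev
    proof eventually_elim
      case (elim r)
      have "0 < a * r powr t" using elim \<open>a > 0\<close> by simp
      then have "ln (a * r powr t) \<le> ln (measure M (ball y r))"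
        using lower[of r] elim by (subst ln_le_cancel_iff) auto
      moreover have "ln (a * r powr t) = ln a + t * ln r"
        using \<open>a > 0\<close> elim by (simp add: ln_mult ln_powr)
      ultimately have "ln (measure M (ball y r)) / ln r \<le> (ln a + t * ln r) / ln r"
        using elim by (intro divide_right_mono_neg) auto
      then show ?case using elim by (simp add: add_divide_distrib add.commute)
    qed
  qed
  then show ?thesis
    unfolding upper_local_dim_def
    by (intro lim_imp_Limsup) (auto intro: tendsto_ereal)
qed

text \<open>
  A power law at a single point of the support already bounds the regularity dimension from below:
  compare the balls of radii \<open>1\<close> and \<open>1 / n\<close>.
\<close>

lemma upper_reg_dim_ge_of_power_bounds:
  assumes "y \<in> measure_support M" "a > 0"
    and lower: "\<And>r. 0 < r \<Longrightarrow> r \<le> 1 \<Longrightarrow> a * r powr t \<le> measure M (ball y r)"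
    and upper: "\<And>r. 0 < r \<Longrightarrow> r \<le> 1 \<Longrightarrow> measure M (ball y r) \<le> b * r powr t"
  shows "ereal t \<le> upper_reg_dim M"
proof (rule upper_reg_dim_geI)
  fix s C :: real
  assume H: "\<And>r R y. 0 < r \<Longrightarrow> r < R \<Longrightarrow> y \<in> measure_support M \<Longrightarrow>
       measure M (ball y R) / measure M (ball y r) \<le> C * (R / r) powr s"
  have "a \<le> b" using lower[of 1] upper[of 1] by simp
  with \<open>a > 0\<close> have "b > 0" by simp
  show "t \<le> s"
  proof (rule powr_growth_le_imp_exponent_le)
    fix n :: nat assume "n \<ge> 2"
    define r where "r = 1 / real n"
    have r: "0 < r" "r < 1" using \<open>n \<ge> 2\<close> by (auto simp: r_def)
    have pos: "0 < measure M (ball y r)"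
      using lower[of r] r \<open>a > 0\<close> by (smt (verit) mult_pos_pos powr_gt_zero)
    have "a \<le> measure M (ball y 1)" using lower[of 1] by simp
    also have "\<dots> \<le> C * (1 / r) powr s * measure M (ball y r)"
      using H[of r 1 y] r assms(1) pos by (simp add: divide_le_eq)
    also have "\<dots> = C * real n powr s * measure M (ball y r)" by (simp add: r_def)
    finally have *: "a \<le> C * real n powr s * measure M (ball y r)" .
    have "C * real n powr s > 0"
      using * pos \<open>a > 0\<close> by (smt (verit) mult_nonpos_nonneg)
    then have "C * real n powr s * measure M (ball y r) \<le> C * real n powr s * (b * r powr t)"
      using upper[of r] r by (intro mult_left_mono) auto
    also have "r powr t = 1 / real n powr t"
      using \<open>n \<ge> 2\<close> by (simp add: r_def powr_divide)
    finally have "a \<le> C * real n powr s * (b * (1 / real n powr t))" using * by linarith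
    then show "real n powr t \<le> (C * b / a) * real n powr s"
      using \<open>a > 0\<close> \<open>n \<ge> 2\<close> by (simp add: field_simps)
  qed
qed

lemma assouad_dim_leI:
  assumes "s \<ge> 0" "C > 0"
    and "\<And>r R y. 0 < r \<Longrightarrow> r < R \<Longrightarrow> y \<in> F \<Longrightarrow>
       \<exists>T. finite T \<and> real (card T) \<le> C * (R / r) powr s \<and> ball y R \<inter> F \<subseteq> (\<Union>t\<in>T. ball t r)"
  shows "assouad_dim F \<le> ereal s"
  unfolding assouad_dim_def using assms by (intro Inf_lower) blast

lemma assouad_dim_nonneg: "assouad_dim F \<ge> 0"
  unfolding assouad_dim_def by (intro Inf_greatest) auto

lemma assouad_dim_real_le_1:
  fixes F :: "real set"
  shows "assouad_dim F \<le> 1"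
proof -
  have "assouad_dim F \<le> ereal 1"
  proof (rule assouad_dim_leI)
    fix r R y :: real assume rR: "0 < r" "r < R"
    define m where "m = \<lceil>R / r\<rceil>"
    define T where "T = (\<lambda>i. y + of_int i * r) ` {-m..m}"
    have m: "R / r \<le> of_int m" "of_int m < R / r + 1" by (auto simp: m_def) linarith
    have Rr: "R / r > 1" using rR by simp
    with m have "m \<ge> 1" by linarith
    have "card T \<le> card {-m..m}" unfolding T_def by (rule card_image_le) simp
    also have "\<dots> = nat (2 * m + 1)" by simp
    finally have "real (card T) \<le> 2 * of_int m + 1" using \<open>m \<ge> 1\<close> by linarith
    also have "\<dots> \<le> 5 * (R / r)" using m Rr by linarith
    also have "\<dots> = 5 * (R / r) powr 1" using rR by simp
    finally have card: "real (card T) \<le> 5 * (R / r) powr 1" .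
    have "z \<in> (\<Union>t\<in>T. ball t r)" if "z \<in> ball y R" for z
    proof -
      define i where "i = \<lfloor>(z - y) / r\<rfloor>"
      have zy: "\<bar>z - y\<bar> < R" using that by (simp add: dist_real_def abs_minus_commute)
      have "(z - y) / r < R / r" "- (R / r) < (z - y) / r"
        using zy rR divide_strict_right_mono[of "-R" "z - y" r]
        by (auto simp: divide_strict_right_mono)
      then have "i \<in> {-m..m}" unfolding i_def using m(1)
        by (auto simp: le_floor_iff floor_le_iff)
      moreover have "of_int i \<le> (z - y) / r" "(z - y) / r < of_int i + 1"
        by (auto simp: i_def)
      then have "of_int i * r \<le> z - y" "z - y < of_int i * r + r"
        using rR by (auto simp: field_simps)
      then have "z \<in> ball (y + of_int i * r) r" by (simp add: dist_real_def)
      ultimately show ?thesis by (auto simp: T_def)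
    qed
    then show "\<exists>T. finite T \<and> real (card T) \<le> 5 * (R / r) powr 1 \<and>
        ball y R \<inter> F \<subseteq> (\<Union>t\<in>T. ball t r)"
      using card by (intro exI[of _ T]) (auto simp: T_def)
  qed auto
  then show ?thesis by (simp add: one_ereal_def)
qed

text \<open>
  Two points of one ball of radius \<open>r\<close> are less than \<open>2 * r\<close> apart, so a separated set needs a
  separate ball for each of its points.
\<close>

lemma assouad_cover_card_ge:
  fixes S :: "'a::metric_space set"
  assumes "finite T" "S \<subseteq> (\<Union>t\<in>T. ball t r)"
    and sep: "\<And>u v. u \<in> S \<Longrightarrow> v \<in> S \<Longrightarrow> u \<noteq> v \<Longrightarrow> 2 * r \<le> dist u v"
  shows "card S \<le> card T"
proof -
  have "\<forall>u\<in>S. \<exists>t\<in>T. u \<in> ball t r" using assms(2) by blast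
  then obtain f where f: "\<And>u. u \<in> S \<Longrightarrow> f u \<in> T" "\<And>u. u \<in> S \<Longrightarrow> u \<in> ball (f u) r"
    by metis
  have "inj_on f S"
  proof (rule inj_onI, rule ccontr)
    fix u v assume uv: "u \<in> S" "v \<in> S" "f u = f v" "u \<noteq> v"
    then have "dist u v < r + r"
      using f(2)[of u] f(2)[of v] by (metis dist_triangle_less_add dist_commute mem_ball)
    with sep uv show False by fastforce
  qed
  then show ?thesis using f(1) assms(1) by (intro card_inj_on_le) auto
qed

section \<open>Point masses along a null sequence\<close>

locale null_sequence_masses =
  fixes x p :: "nat \<Rightarrow> real"
  assumes x_lim: "x \<longlonglongrightarrow> 0"
    and p_pos: "\<And>n. n \<ge> 1 \<Longrightarrow> 0 < p n"
    and p_summable: "summable (\<lambda>n. p (Suc n))"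
begin

abbreviation M :: "real measure" where
  "M \<equiv> normalized_point_masses x p"

definition scale :: real where
  "scale = 1 / (\<Sum>n. p (Suc n))"

lemma scale_pos: "scale > 0"
  using p_pos p_summable by (auto simp: scale_def intro!: suminf_pos)

sublocale prob_space M
  using p_pos p_summable by (rule prob_space_normalized_point_masses)

lemma p_summable_on: "K \<subseteq> {1..} \<Longrightarrow> p summable_on K"
proof -
  have "(p \<circ> Suc) summable_on UNIV"
    using p_summable p_pos by (intro summable_nonneg_imp_summable_on) (auto simp: o_def less_imp_le)
  then have "p summable_on (Suc ` UNIV)"
    by (subst summable_on_reindex) auto
  moreover have "Suc ` UNIV = {1..}"
    by (auto simp: image_iff Suc_le_eq gr0_conv_Suc)
  ultimately show "K \<subseteq> {1..} \<Longrightarrow> p summable_on K"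
    using summable_on_subset_banach by metis
qed

text \<open>
  Measuring by an unordered sum over the indices of the points in the set makes comparison of measures
  a matter of comparing index sets.
\<close>

lemma measure_eq_infsum:
  assumes "A \<in> sets borel"
  shows "measure M A = scale * infsum p {k. k \<ge> 1 \<and> x k \<in> A}"
proof -
  let ?f = "\<lambda>n. p (Suc n) * indicator A (x (Suc n))"
  have nn: "0 \<le> ?f n" for n using p_pos[of "Suc n"] by (auto simp: indicator_def)
  have sm: "summable ?f"
    using p_summable p_pos
    by (intro summable_comparison_test[OF _ p_summable])
       (auto simp: indicator_def less_imp_le intro!: exI[of _ 0])
  have "emeasure M A = ennreal scale * (\<Sum>n. ennreal (p (Suc n)) * indicator A (x (Suc n)))"
    using emeasure_normalized_point_masses[OF assms] by (simp add: scale_def)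
  also have "(\<lambda>n. ennreal (p (Suc n)) * indicator A (x (Suc n))) = (\<lambda>n. ennreal (?f n))"
    by (auto simp: indicator_def)
  also have "(\<Sum>n. ennreal (?f n)) = ennreal (\<Sum>n. ?f n)"
    using nn sm by (rule suminf_ennreal2)
  also have "ennreal scale * \<dots> = ennreal (scale * (\<Sum>n. ?f n))"
    using scale_pos suminf_nonneg[OF sm nn] by (simp add: ennreal_mult)
  finally have "measure M A = scale * (\<Sum>n. ?f n)"
    using scale_pos suminf_nonneg[OF sm nn] by (simp add: measure_def)
  also have "(\<Sum>n. ?f n) = infsum ?f UNIV"
    using sums_nonneg_imp_has_sum[OF summable_sums[OF sm] nn] by (simp add: infsumI)
  also have "\<dots> = infsum (\<lambda>n. p (Suc n)) {n. x (Suc n) \<in> A}"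
    by (rule infsum_cong_neutral) (auto simp: indicator_def)
  also have "\<dots> = infsum p (Suc ` {n. x (Suc n) \<in> A})"
    by (simp add: infsum_reindex o_def)
  also have "Suc ` {n. x (Suc n) \<in> A} = {k. k \<ge> 1 \<and> x k \<in> A}"
    by (auto simp: image_iff Suc_le_eq gr0_conv_Suc)
  finally show ?thesis .
qed

lemma measure_le_infsum:
  assumes "A \<in> sets borel" "K \<subseteq> {1..}" "\<And>k. k \<ge> 1 \<Longrightarrow> x k \<in> A \<Longrightarrow> k \<in> K"
  shows "measure M A \<le> scale * infsum p K"
  unfolding measure_eq_infsum[OF assms(1)] using scale_pos assms p_pos
  by (intro mult_left_mono infsum_mono2 p_summable_on) (auto simp: less_imp_le)

lemma infsum_le_measure:
  assumes "A \<in> sets borel" "K \<subseteq> {1..}" "\<And>k. k \<in> K \<Longrightarrow> x k \<in> A"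
  shows "scale * infsum p K \<le> measure M A"
  unfolding measure_eq_infsum[OF assms(1)] using scale_pos assms p_pos
  by (intro mult_left_mono infsum_mono2 p_summable_on) (auto simp: less_imp_le)

text \<open>
  The points together with their limit form a compact set of full measure, and every neighbourhood of
  \<open>0\<close> contains an atom.
\<close>

lemma measure_support_eq: "measure_support M = insert 0 (x ` {1..})"
proof (intro equalityI subsetI)
  fix y assume y: "y \<in> measure_support M"
  show "y \<in> insert 0 (x ` {1..})"
  proof (rule ccontr)
    assume "y \<notin> insert 0 (x ` {1..})"
    moreover have "x ` {1..} = range (\<lambda>n. x (Suc n))"
      by (force simp: image_iff Suc_le_eq gr0_conv_Suc)
    ultimately have "y \<in> - insert 0 (range (\<lambda>n. x (Suc n)))" by simp
    moreover have "closed (insert 0 (range (\<lambda>n. x (Suc n))))"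
      using x_lim by (intro compact_imp_closed compact_sequence_with_limit LIMSEQ_Suc)
    ultimately have "emeasure M (- insert 0 (range (\<lambda>n. x (Suc n)))) > 0" (is "emeasure M ?U > 0")
      using y by (auto simp: measure_support_def open_Compl)
    moreover have "measure M ?U \<le> scale * infsum p {}"
      using \<open>closed _\<close>
      by (intro measure_le_infsum) (auto simp: Suc_le_eq gr0_conv_Suc)
    ultimately show False by (simp add: emeasure_eq_measure)
  qed
next
  fix y assume y: "y \<in> insert 0 (x ` {1..})"
  show "y \<in> measure_support M"
    unfolding measure_support_def
  proof (intro CollectI allI impI)
    fix U assume U: "open U" "y \<in> U"
    have "\<exists>k\<ge>1. x k \<in> U"
    proof (cases "y = 0")
      case True
      then have "eventually (\<lambda>k. x k \<in> U) sequentially"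
        using x_lim U by (auto simp: tendsto_def)
      with eventually_ge_at_top[of 1] have "eventually (\<lambda>k. k \<ge> 1 \<and> x k \<in> U) sequentially"
        by eventually_elim auto
      then show ?thesis by (auto simp: eventually_sequentially)
    qed (use y U in auto)
    then obtain k where k: "k \<ge> 1" "x k \<in> U" by blast
    have "0 < scale * infsum p {k}" using k scale_pos p_pos by simp
    also have "\<dots> \<le> measure M U"
      using k U by (intro infsum_le_measure) auto
    finally show "0 < emeasure M U" by (simp add: emeasure_eq_measure)
  qed
qed

lemma upper_local_dim_atom:
  assumes "k \<ge> 1"
  shows "upper_local_dim (x k) M = 0"
proof -
  have "upper_local_dim (x k) M = ereal 0"
  proof (rule upper_local_dim_eqI)
    show "scale * p k > 0" using assms scale_pos p_pos by simp
    fix r :: real assume "0 < r"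
    then have "scale * infsum p {k} \<le> measure M (ball (x k) r)"
      using assms by (intro infsum_le_measure) auto
    then show "scale * p k * r powr 0 \<le> measure M (ball (x k) r)" using \<open>0 < r\<close> by simp
    show "measure M (ball (x k) r) \<le> 1 * r powr 0" using \<open>0 < r\<close> by simp
  qed
  then show ?thesis by (simp add: zero_ereal_def)
qed

text \<open>
  Only the accumulation point matters, since the local dimension vanishes at atoms.
\<close>

lemma SUP_upper_local_dim:
  assumes "upper_local_dim 0 M = ereal t" "t \<ge> 0"
  shows "(SUP y\<in>measure_support M. upper_local_dim y M) = ereal t"
proof (rule antisym)
  show "(SUP y\<in>measure_support M. upper_local_dim y M) \<le> ereal t"
    using assms upper_local_dim_atom by (intro SUP_least) (auto simp: measure_support_eq)
  show "ereal t \<le> (SUP y\<in>measure_support M. upper_local_dim y M)"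
    using assms(1) by (intro SUP_upper2[of 0]) (auto simp: measure_support_eq)
qed

end

section \<open>Polynomial positions and polynomial weights\<close>

locale power_law_masses = null_sequence_masses x p for x p :: "nat \<Rightarrow> real" +
  fixes l w :: real
  assumes l_pos: "l > 0" and w_gt_1: "w > 1"
    and x_eq: "\<And>n. n \<ge> 1 \<Longrightarrow> x n = real n powr -l"
    and p_eq: "\<And>n. n \<ge> 1 \<Longrightarrow> p n = real n powr -w"
begin

text \<open>
  The mass of the points from index \<open>n\<close> on is comparable to \<open>n powr (1 - w)\<close>, which is
  \<open>x n powr t\<close>; so \<open>t\<close> is the local dimension at the origin.
\<close>

definition t :: real where
  "t = (w - 1) / l"

lemma t_pos: "t > 0"
  using l_pos w_gt_1 by (simp add: t_def)

lemma exponent_eq: "-1 / l * (1 - w) = t"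
  using l_pos by (simp add: t_def field_simps)

lemma x_pos: "n \<ge> 1 \<Longrightarrow> 0 < x n"
  by (simp add: x_eq)

lemma x_le_1: "n \<ge> 1 \<Longrightarrow> x n \<le> 1"
  using l_pos powr_mono2'[of "-l" 1 "real n"] by (simp add: x_eq)

lemma x_powr_t: "n \<ge> 1 \<Longrightarrow> x n powr t = real n powr (1 - w)"
  using l_pos by (simp add: x_eq t_def powr_powr)

lemma x_less_iff: "n \<ge> 1 \<Longrightarrow> R > 0 \<Longrightarrow> x n < R \<longleftrightarrow> R powr (-1 / l) < real n"
proof -
  assume *: "n \<ge> 1" "R > 0"
  have "x n < R \<longleftrightarrow> real n powr -l < (R powr (-1/l)) powr -l"
    using * l_pos by (simp add: x_eq powr_powr)
  also have "\<dots> \<longleftrightarrow> R powr (-1 / l) < real n"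
    using * l_pos by (subst powr_minus_less_iff) auto
  finally show ?thesis .
qed

lemma block_mass_ge:
  assumes "n \<ge> 1" "m \<le> n"
  shows "real (m + 1) * (2 powr -w * real n powr -w) \<le> infsum p {n..n + m}"
  using block_sum_powr_ge[OF assms, of w] assms w_gt_1 by (simp add: p_eq)

lemma tail_mass_le:
  assumes "N \<ge> 1"
  shows "infsum p {N..} \<le> 2 powr w / (w - 1) * real N powr (1 - w)"
proof (rule infsum_le_finite_sums)
  show "p summable_on {N..}" using assms by (intro p_summable_on) auto
  fix F assume F: "finite F" "F \<subseteq> {N..}"
  define D where "D = 2 powr w / (w - 1)"
  have D: "D > 0" using w_gt_1 by (simp add: D_def)
  have step: "p k \<le> D * (real k powr (1 - w) - real (Suc k) powr (1 - w))" if "k \<ge> N" for k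
  proof -
    have k: "k \<ge> 1" using that assms by simp
    have "p k = 2 powr w * (2 * real k) powr -w"
      using k by (simp add: p_eq powr_mult powr_minus field_simps)
    also have "\<dots> \<le> 2 powr w * real (Suc k) powr -w"
      using k w_gt_1 by (intro mult_left_mono powr_mono2') auto
    also have "\<dots> = D * ((w - 1) * real (Suc k) powr (-(w - 1) - 1) * (real (Suc k) - real k))"
      using w_gt_1 by (simp add: D_def)
    also have "\<dots> \<le> D * (real k powr -(w - 1) - real (Suc k) powr -(w - 1))"
      using k w_gt_1 D powr_minus_diff_bounds(1)[of "real k" "real (Suc k)" "w - 1"]
      by (intro mult_left_mono) auto
    finally show ?thesis by simp
  qed
  have "\<exists>n. F \<subseteq> {N..<N + n}"
    using F by (metis add.commute finite_nat_set_iff_bounded subsetD subsetI atLeastLessThan_iff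
        atLeast_iff trans_less_add2)
  then obtain n where n: "F \<subseteq> {N..<N + n}" by blast
  have "sum p F \<le> sum p {N..<N + n}"
    using n assms p_pos by (intro sum_mono2) (auto simp: less_imp_le)
  also have "\<dots> \<le> D * (real N powr (1 - w) - real (N + n) powr (1 - w))"
  proof (induction n)
    case (Suc n)
    have "sum p {N..<N + Suc n} = sum p {N..<N + n} + p (N + n)" by simp
    also have "\<dots> \<le> D * (real N powr (1 - w) - real (N + n) powr (1 - w))
        + D * (real (N + n) powr (1 - w) - real (Suc (N + n)) powr (1 - w))"
      using Suc step[of "N + n"] by (intro add_mono) auto
    finally show ?case by (simp add: algebra_simps)
  qed simp
  also have "\<dots> \<le> D * real N powr (1 - w)" using D by simp
  finally show "sum p F \<le> 2 powr w / (w - 1) * real N powr (1 - w)" by (simp add: D_def)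
qed

text \<open>
  If \<open>N\<close> is the first index with \<open>x N < r\<close>, then the block from \<open>N\<close> to \<open>2 * N\<close> has mass of order
  \<open>N powr (1 - w)\<close>, that is \<open>r powr t\<close>. The set \<open>A\<close> is arbitrary so that balls around any point close to
  the origin are covered as well.
\<close>

lemma mass_near_origin_ge:
  obtains a where "a > 0"
    "\<And>A r. A \<in> sets borel \<Longrightarrow> 0 < r \<Longrightarrow> r \<le> 1 \<Longrightarrow>
       (\<And>k. k \<ge> 1 \<Longrightarrow> x k < r \<Longrightarrow> x k \<in> A) \<Longrightarrow> a * r powr t \<le> measure M A"
proof
  show "scale * 2 powr (1 - 2 * w) > 0" using scale_pos by simp
  fix A :: "real set" and r :: real
  assume A: "A \<in> sets borel" and r: "0 < r" "r \<le> 1" and sub: "\<And>k. k \<ge> 1 \<Longrightarrow> x k < r \<Longrightarrow> x k \<in> A"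
  define q where "q = r powr (-1 / l)"
  define N where "N = nat \<lfloor>q\<rfloor> + 1"
  have "1 powr (-1 / l) \<le> q"
    unfolding q_def using r l_pos by (intro powr_mono2') (auto simp: divide_le_0_iff)
  then have q: "q \<ge> 1" by simp
  then have N: "N \<ge> 1" "q < real N" "real N \<le> 2 * q" unfolding N_def by linarith+
  have "2 powr (1 - 2 * w) * r powr t = 2 powr -w * (2 * q) powr (1 - w)"
  proof -
    have "q powr (1 - w) = r powr t"
      by (simp only: q_def powr_powr exponent_eq)
    moreover have "(2::real) powr (1 - 2 * w) = 2 powr -w * 2 powr (1 - w)"
      by (simp flip: powr_add)
    ultimately show ?thesis using q by (simp add: powr_mult)
  qed
  also have "\<dots> \<le> 2 powr -w * real N powr (1 - w)"
    using N q w_gt_1 by (intro mult_left_mono powr_mono2') auto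
  also have "\<dots> = real N * (2 powr -w * real N powr -w)"
    using N by (simp add: powr_diff powr_minus field_simps)
  also have "\<dots> \<le> real (N + 1) * (2 powr -w * real N powr -w)"
    by (intro mult_right_mono) auto
  also have "\<dots> \<le> infsum p {N..N + N}" using N by (intro block_mass_ge) auto
  finally have "scale * (2 powr (1 - 2 * w) * r powr t) \<le> scale * infsum p {N..N + N}"
    using scale_pos by (intro mult_left_mono) auto
  also have "\<dots> \<le> measure M A"
  proof (rule infsum_le_measure[OF A])
    fix k assume "k \<in> {N..N + N}"
    then have "k \<ge> 1" "q < real k" using N by auto
    then show "x k \<in> A" using r by (intro sub) (auto simp: x_less_iff q_def)
  qed (use N in auto)
  finally show "scale * 2 powr (1 - 2 * w) * r powr t \<le> measure M A" by (simp add: mult_ac)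
qed

lemma mass_near_origin_le:
  obtains b where "b > 0"
    "\<And>A R. A \<in> sets borel \<Longrightarrow> 0 < R \<Longrightarrow> (\<And>k. k \<ge> 1 \<Longrightarrow> x k \<in> A \<Longrightarrow> x k < R) \<Longrightarrow>
       measure M A \<le> b * R powr t"
proof
  show "scale * (2 powr w / (w - 1)) > 0" using scale_pos w_gt_1 by simp
  fix A :: "real set" and R :: real
  assume A: "A \<in> sets borel" and R: "0 < R" and sub: "\<And>k. k \<ge> 1 \<Longrightarrow> x k \<in> A \<Longrightarrow> x k < R"
  define q where "q = R powr (-1 / l)"
  define N where "N = nat \<lfloor>q\<rfloor> + 1"
  have q: "q > 0" using R by (simp add: q_def)
  then have N: "N \<ge> 1" "q < real N" unfolding N_def by linarith+
  have "measure M A \<le> scale * infsum p {N..}"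
  proof (rule measure_le_infsum[OF A])
    fix k assume "k \<ge> 1" "x k \<in> A"
    then have "q < real k" using sub[of k] R by (simp add: x_less_iff q_def)
    then show "k \<in> {N..}" using q by (auto simp: N_def) linarith
  qed (use N in auto)
  also have "\<dots> \<le> scale * (2 powr w / (w - 1) * real N powr (1 - w))"
    using N scale_pos by (intro mult_left_mono tail_mass_le) auto
  also have "\<dots> \<le> scale * (2 powr w / (w - 1) * q powr (1 - w))"
    using N q scale_pos w_gt_1 by (intro mult_left_mono powr_mono2') auto
  also have "q powr (1 - w) = R powr t"
    by (simp only: q_def powr_powr exponent_eq)
  finally show "measure M A \<le> scale * (2 powr w / (w - 1)) * R powr t" by simp
qed

text \<open>
  Near \<open>x n\<close> the spacing is of order \<open>x n / n\<close> and each atom has mass of order \<open>n powr -w\<close>. A ball of radius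
  \<open>r \<le> x n\<close> therefore contains, besides \<open>x n\<close>, about \<open>n * r / x n\<close> atoms, which gives the profile
  \<open>(1 / n + r / x n) * n powr (1 - w)\<close>: constant below the spacing and linear above it. For the lower
  bound it suffices to use points to the left of \<open>x n\<close>.
\<close>

lemma mass_near_atom_ge:
  obtains a where "a > 0"
    "\<And>n r. n \<ge> 1 \<Longrightarrow> 0 < r \<Longrightarrow> r \<le> x n \<Longrightarrow>
       a * (1 / real n + r / x n) * real n powr (1 - w) \<le> measure M (ball (x n) r)"
proof
  \<comment> \<open>the first bound on \<open>d\<close> keeps the indices at most \<open>2 * n\<close>, the second one the points in the ball\<close>
  define d where "d = min 1 (1 / (2 * l))"
  have d: "d > 0" "d \<le> 1" "l * d \<le> 1 / 2"
    using l_pos by (auto simp: d_def min_def field_simps)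
  show "scale * (d / 2 * 2 powr -w) > 0" using scale_pos d by simp
  fix n :: nat and r :: real
  assume n: "n \<ge> 1" and r: "0 < r" "r \<le> x n"
  have xn: "x n > 0" using n by (rule x_pos)
  define u where "u = d * (real n * (r / x n))"
  define j where "j = nat \<lfloor>u\<rfloor>"
  have rx: "0 < r / x n" "r / x n \<le> 1" using r xn by auto
  have u: "u > 0" unfolding u_def using d n rx by (intro mult_pos_pos) auto
  have "u \<le> 1 * (real n * 1)"
    unfolding u_def using d rx r xn by (intro mult_mono) auto
  then have j: "j \<le> n" "real j \<le> u" "u < real j + 1"
    using u unfolding j_def by linarith+
  have "d / 2 * (1 / real n + r / x n) * real n powr (1 - w)
      = (d + u) / 2 * real n powr -w"
    using n d by (simp add: u_def powr_diff powr_minus) (simp add: field_simps)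
  also have "\<dots> \<le> real (j + 1) * real n powr -w"
    using d u j by (intro mult_right_mono) auto
  finally have "2 powr -w * (d / 2 * (1 / real n + r / x n) * real n powr (1 - w))
      \<le> 2 powr -w * (real (j + 1) * real n powr -w)"
    by (intro mult_left_mono) auto
  also have "\<dots> \<le> infsum p {n..n + j}"
    using block_mass_ge[OF n j(1)] by (simp add: mult_ac)
  finally have "scale * (2 powr -w * (d / 2 * (1 / real n + r / x n) * real n powr (1 - w)))
      \<le> scale * infsum p {n..n + j}"
    using scale_pos by (intro mult_left_mono) auto
  also have "\<dots> \<le> measure M (ball (x n) r)"
  proof (rule infsum_le_measure)
    fix k assume k: "k \<in> {n..n + j}"
    then have k1: "k \<ge> 1" using n by simp
    have le: "x k \<le> x n"
      using k n k1 l_pos by (auto simp: x_eq intro: powr_mono2')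
    have "x n - x k \<le> l * real n powr (-l - 1) * (real k - real n)"
      using powr_minus_diff_bounds(2)[of "real n" "real k" l] k n l_pos k1 by (simp add: x_eq)
    also have "\<dots> \<le> l * real n powr (-l - 1) * u"
      using k j l_pos by (intro mult_left_mono) auto
    also have "\<dots> = l * d * r"
      using n by (simp add: u_def x_eq powr_diff)
    also have "\<dots> \<le> 1 / 2 * r" using d r by (intro mult_right_mono) auto
    also have "\<dots> < r" using r by simp
    finally show "x k \<in> ball (x n) r" using le by (simp add: dist_real_def)
  qed (use n in auto)
  finally show "scale * (d / 2 * 2 powr -w) * (1 / real n + r / x n) * real n powr (1 - w)
      \<le> measure M (ball (x n) r)" by (simp add: mult_ac)
qed

text \<open>
  The matching upper bound holds as long as the ball stays away from the origin. There the indices of its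
  points are comparable to \<open>n\<close>, with ratio between \<open>1 / B\<close> and \<open>B\<close>, so that the spacing and
  the weights do not change by more than a constant factor.
\<close>

lemma mass_near_atom_le:
  obtains b where "b > 0"
    "\<And>n R. n \<ge> 1 \<Longrightarrow> 0 < R \<Longrightarrow> R \<le> x n / 2 \<Longrightarrow>
       measure M (ball (x n) R) \<le> b * (1 / real n + R / x n) * real n powr (1 - w)"
proof
  \<comment> \<open>\<open>B\<close> bounds the ratio of the indices of two points whose own ratio is at most \<open>2\<close>\<close>
  define B where "B = 2 powr (1 / l)"
  define G where "G = B powr (l + 1) / l"
  have B1: "B \<ge> 1" unfolding B_def using l_pos by (intro ge_one_powr_ge_zero) auto
  have G: "G > 0" using B1 l_pos by (simp add: G_def)
  have Bl: "B powr -l = 1 / 2"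
    using l_pos by (simp add: B_def powr_powr powr_minus)
  show "scale * ((2 * G + 1) * B powr w) > 0" using scale_pos G B1 by simp
  fix n :: nat and R :: real
  assume n: "n \<ge> 1" and R: "0 < R" "R \<le> x n / 2"
  have xn: "x n > 0" using n by (rule x_pos)
  define D where "D = G * (real n * (R / x n))"
  have D: "D > 0" using G n R xn by (simp add: D_def)
  define J where "J = {k::nat. real n - D \<le> real k \<and> real k \<le> real n + D}"
  define K where "K = {k \<in> J. k \<ge> 1 \<and> real n / B \<le> real k}"
  have J: "finite J" "real (card J) \<le> 2 * D + 1"
    using card_nats_in_real_interval[of "real n - D" "real n + D"] D by (simp_all add: J_def)
  have "measure M (ball (x n) R) \<le> scale * infsum p K"
  proof (rule measure_le_infsum)
    fix k assume k: "k \<ge> 1" "x k \<in> ball (x n) R"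
    have dist: "\<bar>x k - x n\<bar> < R" using k by (simp add: dist_real_def abs_minus_commute)
    then have "x n / 2 < x k" "x k < 2 * x n" using R xn by linarith+
    moreover have "(B * real n) powr -l = x n / 2" "(real n / B) powr -l = 2 * x n"
      using B1 n by (simp_all add: x_eq powr_mult powr_divide Bl)
    ultimately have "(B * real n) powr -l < real k powr -l" "real k powr -l < (real n / B) powr -l"
      using k by (simp_all add: x_eq)
    then have kB: "real k < B * real n" "real n / B < real k"
      using k n B1 l_pos by (simp_all add: powr_minus_less_iff)
    have *: "l * (B * real n) powr (-l - 1) * \<bar>real k - real n\<bar> \<le> \<bar>x k - x n\<bar>"
    proof -
      have main: "l * (B * real n) powr (-l - 1) * (real v - real u) \<le> x u - x v"
        if "u \<ge> 1" "u \<le> v" "real v \<le> B * real n" for u v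
      proof -
        have "l * (B * real n) powr (-l - 1) * (real v - real u)
            \<le> l * real v powr (-l - 1) * (real v - real u)"
          using that l_pos by (intro mult_left_mono mult_right_mono powr_mono2') auto
        also have "\<dots> \<le> x u - x v"
          using powr_minus_diff_bounds(1)[of "real u" "real v" l] that l_pos by (simp add: x_eq)
        finally show ?thesis .
      qed
      have "real n \<le> B * real n" using B1 n by simp
      then show ?thesis
        using main[of k n] main[of n k] k n kB by (cases "k \<le> n") auto
    qed
    then have "l * (B * real n) powr (-l - 1) * \<bar>real k - real n\<bar> \<le> R" using dist by linarith
    moreover have "l * (B * real n) powr (-l - 1) * D = R"
    proof -
      have "(B * real n) powr (-l - 1) = 1 / B powr (l + 1) * (x n / real n)"
        using B1 n by (simp add: powr_mult x_eq powr_diff powr_minus powr_add field_simps)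
      then show ?thesis
        using B1 n l_pos xn by (simp add: D_def G_def)
    qed
    ultimately have "l * (B * real n) powr (-l - 1) * \<bar>real k - real n\<bar>
        \<le> l * (B * real n) powr (-l - 1) * D" by simp
    then have "\<bar>real k - real n\<bar> \<le> D"
      by (rule mult_left_le_imp_le) (use l_pos B1 n in auto)
    then show "k \<in> K" using kB k by (auto simp: K_def J_def)
  qed (auto simp: K_def)
  also have "infsum p K = sum p K" using J by (simp add: K_def)
  also have "sum p K \<le> of_nat (card K) * (real n / B) powr -w"
  proof (rule sum_bounded_above)
    fix k assume "k \<in> K"
    then show "p k \<le> (real n / B) powr -w"
      using B1 n w_gt_1 by (auto simp: K_def p_eq intro!: powr_mono2')
  qed
  also have "\<dots> \<le> (2 * D + 1) * (real n / B) powr -w"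
  proof (rule mult_right_mono)
    have "card K \<le> card J" using J by (intro card_mono) (auto simp: K_def)
    then show "of_nat (card K) \<le> 2 * D + 1" using J by linarith
  qed simp
  also have "(real n / B) powr -w = B powr w * real n powr -w"
    using B1 n by (simp add: powr_divide powr_minus field_simps)
  also have "(2 * D + 1) * \<dots> \<le> ((2 * G + 1) * (real n * (1 / real n + R / x n))) * \<dots>"
  proof (rule mult_right_mono)
    have "D \<le> G * (real n * (1 / real n + R / x n))"
      using G n by (simp add: D_def distrib_left)
    moreover have "1 \<le> real n * (1 / real n + R / x n)"
      using n R xn by (simp add: distrib_left)
    ultimately show "2 * D + 1 \<le> (2 * G + 1) * (real n * (1 / real n + R / x n))"
      by (simp only: distrib_right mult.assoc)
  qed simp
  finally have "measure M (ball (x n) R) \<le>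
     scale * ((2 * G + 1) * (real n * (1 / real n + R / x n)) * (B powr w * real n powr -w))"
    using scale_pos by simp
  also have "real n powr -w = real n powr (1 - w) / real n"
    using n by (simp add: powr_diff powr_minus field_simps)
  finally show "measure M (ball (x n) R) \<le>
      scale * ((2 * G + 1) * B powr w) * (1 / real n + R / x n) * real n powr (1 - w)"
    using n by (simp add: mult_ac)
qed

lemma measure_ball_0_bounds:
  obtains a b where "a > 0"
    "\<And>r. 0 < r \<Longrightarrow> r \<le> 1 \<Longrightarrow> a * r powr t \<le> measure M (ball 0 r)"
    "\<And>r. 0 < r \<Longrightarrow> r \<le> 1 \<Longrightarrow> measure M (ball 0 r) \<le> b * r powr t"
proof -
  obtain a where a: "a > 0"
    "\<And>A r. A \<in> sets borel \<Longrightarrow> 0 < r \<Longrightarrow> r \<le> 1 \<Longrightarrow>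
       (\<And>k. k \<ge> 1 \<Longrightarrow> x k < r \<Longrightarrow> x k \<in> A) \<Longrightarrow> a * r powr t \<le> measure M A"
    using mass_near_origin_ge by blast
  obtain b where b:
    "\<And>A R. A \<in> sets borel \<Longrightarrow> 0 < R \<Longrightarrow> (\<And>k. k \<ge> 1 \<Longrightarrow> x k \<in> A \<Longrightarrow> x k < R) \<Longrightarrow>
       measure M A \<le> b * R powr t"
    using mass_near_origin_le by blast
  have ball: "x k \<in> ball 0 r \<longleftrightarrow> x k < r" if "k \<ge> 1" for k r
    using x_pos[OF that] by (simp add: dist_real_def)
  show thesis
  proof (rule that)
    show "a * r powr t \<le> measure M (ball 0 r)" "measure M (ball 0 r) \<le> b * r powr t"
      if "0 < r" "r \<le> 1" for r
      using that by (auto intro!: a(2) b simp only: ball borel_open open_ball)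
  qed (rule a(1))
qed

lemma SUP_upper_local_dim_eq: "(SUP y\<in>measure_support M. upper_local_dim y M) = ereal t"
proof -
  obtain a b where "a > 0"
    "\<And>r. 0 < r \<Longrightarrow> r \<le> 1 \<Longrightarrow> a * r powr t \<le> measure M (ball 0 r)"
    "\<And>r. 0 < r \<Longrightarrow> r \<le> 1 \<Longrightarrow> measure M (ball 0 r) \<le> b * r powr t"
    using measure_ball_0_bounds by blast
  then have "upper_local_dim 0 M = ereal t"
    by (intro upper_local_dim_eqI[of a t _ _ b]) auto
  then show ?thesis using t_pos by (intro SUP_upper_local_dim) auto
qed

text \<open>
  Three profiles have to be compared: the power law with exponent \<open>t\<close> for balls that reach the origin,
  the linear growth between the spacing and the distance to the origin, and the constant mass of an isolated
  atom. Growth from radius \<open>r\<close> to radius \<open>R\<close> passes through these regimes, with exponents \<open>t\<close>,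
  \<open>1\<close> and \<open>0\<close>, so the largest of them bounds it.
\<close>

lemma upper_reg_dim_le: "upper_reg_dim M \<le> ereal (max 1 t)"
proof -
  define s where "s = max 1 t"
  have s: "1 \<le> s" "t \<le> s" by (auto simp: s_def)
  obtain a0 where a0: "a0 > 0"
    "\<And>A r. A \<in> sets borel \<Longrightarrow> 0 < r \<Longrightarrow> r \<le> 1 \<Longrightarrow>
       (\<And>k. k \<ge> 1 \<Longrightarrow> x k < r \<Longrightarrow> x k \<in> A) \<Longrightarrow> a0 * r powr t \<le> measure M A"
    using mass_near_origin_ge by blast
  obtain b0 where b0: "b0 > 0"
    "\<And>A R. A \<in> sets borel \<Longrightarrow> 0 < R \<Longrightarrow> (\<And>k. k \<ge> 1 \<Longrightarrow> x k \<in> A \<Longrightarrow> x k < R) \<Longrightarrow>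
       measure M A \<le> b0 * R powr t"
    using mass_near_origin_le by blast
  obtain a1 where a1: "a1 > 0"
    "\<And>n r. n \<ge> 1 \<Longrightarrow> 0 < r \<Longrightarrow> r \<le> x n \<Longrightarrow>
       a1 * (1 / real n + r / x n) * real n powr (1 - w) \<le> measure M (ball (x n) r)"
    using mass_near_atom_ge by blast
  obtain b1 where b1: "b1 > 0"
    "\<And>n R. n \<ge> 1 \<Longrightarrow> 0 < R \<Longrightarrow> R \<le> x n / 2 \<Longrightarrow>
       measure M (ball (x n) R) \<le> b1 * (1 / real n + R / x n) * real n powr (1 - w)"
    using mass_near_atom_le by blast
  define C where "C = 1 / a0 + b0 * 2 powr t / a0 + b0 * 3 powr t * 2 powr s / a1 + b1 / a1"
  have C: "1 / a0 \<le> C" "b0 * 2 powr t / a0 \<le> C" "b0 * 3 powr t * 2 powr s / a1 \<le> C"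
    "b1 / a1 \<le> C" "C > 0"
    using a0(1) b0(1) a1(1) b1(1) unfolding C_def by (auto intro!: add_pos_pos)
  have "upper_reg_dim M \<le> ereal s"
  proof (rule upper_reg_dim_leI)
    fix r R y :: real
    assume r: "0 < r" and rR: "r < R" and y: "y \<in> measure_support M"
    have y01: "0 \<le> y" "y \<le> 1"
      using y x_pos x_le_1 by (auto simp: measure_support_eq less_imp_le)
    have Rr1: "1 \<le> R / r" using r rR by simp
    then have Rrs: "1 \<le> (R / r) powr s" "R / r \<le> (R / r) powr s" "(R / r) powr t \<le> (R / r) powr s"
      using s powr_mono[of 1 s "R / r"] r rR by (auto intro: ge_one_powr_ge_zero powr_mono)
    have "\<exists>q\<le>C. measure M (ball y R) \<le> q * (R / r) powr s * measure M (ball y r)"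
    proof -
      consider "r \<ge> 1" | "r < 1" "y \<le> r" | "r < y" "y \<le> 2 * R" | "r < y" "2 * R < y"
        by linarith
      then show ?thesis
      proof cases
        \<comment> \<open>the small ball already carries a fixed part of the total mass\<close>
        case 1
        have "a0 * 1 powr t \<le> measure M (ball y r)"
          using 1 y01 x_pos by (intro a0(2)) (fastforce simp: dist_real_def)+
        then have "1 \<le> 1 / a0 * measure M (ball y r)"
          using a0(1) by (simp add: field_simps)
        also have "\<dots> \<le> 1 / a0 * measure M (ball y r) * (R / r) powr s"
          using mult_left_mono[OF Rrs(1), of "1 / a0 * measure M (ball y r)"] a0(1) by simp
        finally have "measure M (ball y R) \<le> 1 / a0 * measure M (ball y r) * (R / r) powr s"
          using prob_le_1 by (rule order_trans[rotated])
        then have "measure M (ball y R) \<le> 1 / a0 * (R / r) powr s * measure M (ball y r)"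
          by (simp only: mult_ac)
        then show ?thesis using C by blast
      next
        \<comment> \<open>both balls have the scale of the origin: exponent \<open>t\<close>\<close>
        case 2
        have low: "a0 * r powr t \<le> measure M (ball y r)"
          using 2 r y01 x_pos by (intro a0(2)) (fastforce simp: dist_real_def)+
        have "measure M (ball y R) \<le> b0 * (2 * R) powr t"
          using 2 r rR y01 by (intro b0(2)) (auto simp: dist_real_def)
        also have "\<dots> = b0 * 2 powr t / a0 * (R / r) powr t * (a0 * r powr t)"
          using a0(1) r rR by (simp add: powr_mult powr_divide)
        also have "\<dots> \<le> b0 * 2 powr t / a0 * (R / r) powr s * measure M (ball y r)"
          using low Rrs a0(1) b0(1) r by (intro mult_mono) auto
        finally show ?thesis using C by blast
      next
        \<comment> \<open>exponent \<open>1\<close> from radius \<open>r\<close> up to \<open>y\<close>, then exponent \<open>t\<close> from \<open>y\<close> up to \<open>R\<close>\<close>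
        case 3
        then obtain n where n: "n \<ge> 1" "y = x n"
          using y r by (auto simp: measure_support_eq)
        have yp: "y > 0" using 3 r by simp
        have "a1 * (r / y) * y powr t \<le> a1 * (1 / real n + r / y) * y powr t"
          using a1(1) by (intro mult_right_mono mult_left_mono) auto
        also have "\<dots> \<le> measure M (ball y r)"
          using a1(2)[OF n(1) r] 3 n by (simp add: x_powr_t)
        finally have low: "a1 * (r / y) * y powr t \<le> measure M (ball y r)" .
        have "(2 * R / y) powr t \<le> (2 * R / y) powr s"
          using s 3 yp by (intro powr_mono) auto
        moreover have "(y / r) powr 1 \<le> (y / r) powr s"
          using s 3 r by (intro powr_mono) auto
        ultimately have "(2 * R / y) powr t * (y / r) \<le> (2 * R / y) powr s * (y / r) powr s"
          using yp r by (intro mult_mono) auto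
        also have "\<dots> = 2 powr s * (R / r) powr s"
          using yp r rR by (simp add: powr_mult powr_divide)
        finally have key: "(2 * R / y) powr t * (y / r) \<le> 2 powr s * (R / r) powr s" .
        have "measure M (ball y R) \<le> b0 * (3 * R) powr t"
          using 3 r rR by (intro b0(2)) (auto simp: dist_real_def)
        also have "\<dots> \<le> b0 * 3 powr t * (2 * R) powr t"
          using b0(1) rR r t_pos by (auto simp: powr_mult ge_one_powr_ge_zero)
        also have "\<dots> = b0 * 3 powr t / a1 * ((2 * R / y) powr t * (y / r)) * (a1 * (r / y) * y powr t)"
          using a1(1) r rR yp by (simp add: powr_mult powr_divide)
        also have "\<dots> \<le> b0 * 3 powr t / a1 * (2 powr s * (R / r) powr s) * measure M (ball y r)"
          using a1(1) b0(1) r yp by (intro mult_mono[OF mult_left_mono[OF key] low]) auto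
        finally have "measure M (ball y R)
            \<le> b0 * 3 powr t * 2 powr s / a1 * (R / r) powr s * measure M (ball y r)" by simp
        then show ?thesis using C by blast
      next
        \<comment> \<open>both balls stay away from the origin: exponent \<open>1\<close>\<close>
        case 4
        then obtain n where n: "n \<ge> 1" "y = x n"
          using y r by (auto simp: measure_support_eq)
        have yp: "y > 0" using 4 r by simp
        have low: "a1 * (1 / real n + r / y) * real n powr (1 - w) \<le> measure M (ball y r)"
          using a1(2)[OF n(1) r] 4 n by simp
        have "1 / real n + R / y \<le> (R / r) * (1 / real n + r / y)"
          using mult_right_mono[OF Rr1, of "1 / real n"] r by (simp add: distrib_left)
        also have "\<dots> \<le> (R / r) powr s * (1 / real n + r / y)"
          using Rrs r yp by (intro mult_right_mono) auto
        finally have key: "1 / real n + R / y \<le> (R / r) powr s * (1 / real n + r / y)" .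
        have "measure M (ball y R) \<le> b1 * (1 / real n + R / y) * real n powr (1 - w)"
          using b1(2)[OF n(1), of R] 4 n r rR by simp
        also have "\<dots> \<le> b1 * ((R / r) powr s * (1 / real n + r / y)) * real n powr (1 - w)"
          using b1(1) key by (intro mult_right_mono mult_left_mono) auto
        also have "\<dots> = b1 / a1 * (R / r) powr s * (a1 * (1 / real n + r / y) * real n powr (1 - w))"
          using a1(1) by simp
        also have "\<dots> \<le> b1 / a1 * (R / r) powr s * measure M (ball y r)"
          using low a1(1) b1(1) by (intro mult_left_mono) auto
        finally show ?thesis using C by blast
      qed
    qed
    then obtain q where "q \<le> C" "measure M (ball y R) \<le> q * (R / r) powr s * measure M (ball y r)"
      by blast
    moreover have "q * (R / r) powr s * measure M (ball y r) \<le> C * (R / r) powr s * measure M (ball y r)"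
      using \<open>q \<le> C\<close> by (intro mult_right_mono) auto
    ultimately show "measure M (ball y R) \<le> C * (R / r) powr s * measure M (ball y r)"
      by linarith
  qed (use s C in auto)
  then show ?thesis by (simp add: s_def)
qed

text \<open>
  Between the spacing \<open>x n / n\<close> and \<open>x n\<close> the mass grows linearly, by a factor of order \<open>n\<close>, while the
  radius grows by the factor \<open>n\<close>.
\<close>

lemma upper_reg_dim_ge_1: "1 \<le> upper_reg_dim M"
proof -
  obtain a where a: "a > 0"
    "\<And>n r. n \<ge> 1 \<Longrightarrow> 0 < r \<Longrightarrow> r \<le> x n \<Longrightarrow>
       a * (1 / real n + r / x n) * real n powr (1 - w) \<le> measure M (ball (x n) r)"
    using mass_near_atom_ge by blast
  obtain b where b: "b > 0"
    "\<And>n R. n \<ge> 1 \<Longrightarrow> 0 < R \<Longrightarrow> R \<le> x n / 2 \<Longrightarrow>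
       measure M (ball (x n) R) \<le> b * (1 / real n + R / x n) * real n powr (1 - w)"
    using mass_near_atom_le by blast
  have "ereal 1 \<le> upper_reg_dim M"
  proof (rule upper_reg_dim_geI)
    fix s C :: real
    assume C: "C > 0" and H: "\<And>r R y. 0 < r \<Longrightarrow> r < R \<Longrightarrow> y \<in> measure_support M \<Longrightarrow>
       measure M (ball y R) / measure M (ball y r) \<le> C * (R / r) powr s"
    show "1 \<le> s"
    proof (rule powr_growth_le_imp_exponent_le)
      fix n :: nat assume "n \<ge> 2"
      then have n: "n \<ge> 1" by simp
      define r where "r = x n / real n"
      have xn: "x n > 0" using n by (rule x_pos)
      have r: "0 < r" "r < x n" "r \<le> x n / 2" "r / x n = 1 / real n" "x n / r = real n"
        using xn \<open>n \<ge> 2\<close> by (auto simp: r_def field_simps)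
      have y: "x n \<in> measure_support M" using n by (auto simp: measure_support_eq)
      have mpos: "measure M (ball (x n) r) > 0"
        using r y finite_measure_axioms by (intro measure_ball_support_pos)
      let ?u = "real n powr (1 - w)"
      have "a * ?u \<le> a * (1 / real n + x n / x n) * ?u"
        using a(1) xn by (intro mult_right_mono) auto
      also have "\<dots> \<le> measure M (ball (x n) (x n))"
        using a(2)[OF n xn] by simp
      also have "\<dots> \<le> C * real n powr s * measure M (ball (x n) r)"
        using H[OF r(1,2) y] mpos r by (simp add: divide_le_eq)
      also have "\<dots> \<le> C * real n powr s * (b * (1 / real n + 1 / real n) * ?u)"
        using b(2)[OF n r(1,3)] r C by (intro mult_left_mono) auto
      also have "\<dots> = (C * real n powr s * (2 * b / real n)) * ?u" by simp
      finally have "a \<le> C * real n powr s * (2 * b / real n)"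
        by (rule mult_right_le_imp_le) (use n in auto)
      then show "real n powr 1 \<le> (2 * b * C / a) * real n powr s"
        using a(1) n by (simp add: field_simps)
    qed
  qed
  then show ?thesis by (simp add: one_ereal_def)
qed

theorem upper_reg_dim_power_law: "upper_reg_dim M = ereal (max 1 t)"
proof (rule antisym)
  obtain a b where "a > 0"
    "\<And>r. 0 < r \<Longrightarrow> r \<le> 1 \<Longrightarrow> a * r powr t \<le> measure M (ball 0 r)"
    "\<And>r. 0 < r \<Longrightarrow> r \<le> 1 \<Longrightarrow> measure M (ball 0 r) \<le> b * r powr t"
    using measure_ball_0_bounds by blast
  then have "ereal t \<le> upper_reg_dim M"
    by (intro upper_reg_dim_ge_of_power_bounds[of 0]) (auto simp: measure_support_eq)
  with upper_reg_dim_ge_1 show "ereal (max 1 t) \<le> upper_reg_dim M"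
    by (auto simp: max_def one_ereal_def)
qed (rule upper_reg_dim_le)

text \<open>
  The points \<open>x n, \<dots>, x (2 * n)\<close> lie at distance of order \<open>x n\<close> from the origin and are separated by a
  distance of order \<open>x n / n\<close>, so covering them at that scale takes more than \<open>n\<close> balls.
\<close>

theorem assouad_dim_power_law: "assouad_dim (measure_support M) = 1"
proof (rule antisym)
  have "ereal 1 \<le> assouad_dim (measure_support M)"
    unfolding assouad_dim_def
  proof (rule Inf_greatest, clarify)
    fix s C :: real
    assume H: "\<forall>r R. 0 < r \<longrightarrow> r < R \<longrightarrow> (\<forall>y\<in>measure_support M.
        \<exists>T. finite T \<and> real (card T) \<le> C * (R / r) powr s \<and>
            ball y R \<inter> measure_support M \<subseteq> (\<Union>t\<in>T. ball t r))"
    define G where "G = (2 + l) * 2 * 2 powr (l + 1) / l"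
    have "1 \<le> s"
    proof (rule powr_growth_le_imp_exponent_le)
      fix n :: nat assume "n \<ge> 2"
      then have n: "n \<ge> 1" by simp
      have xn: "x n > 0" using n by (rule x_pos)
      define g where "g = l * (2 * real n) powr (-l - 1)"
      have g: "g > 0" using l_pos n by (simp add: g_def)
      have gx: "g = l * 2 powr (-l - 1) * (x n / real n)"
        using n by (simp add: g_def powr_mult x_eq powr_diff)
      \<comment> \<open>the summand \<open>l\<close> in the factor ensures \<open>g / 2 < R\<close> for all \<open>n\<close>\<close>
      define R where "R = (2 + l) * x n"
      have "l * 2 powr (-l - 1) * (x n / real n) \<le> l * 1 * (x n / 1)"
        using l_pos n xn powr_mono[of "-l - 1" 0 2]
        by (intro mult_mono divide_left_mono) auto
      then have "g \<le> l * x n" unfolding gx by simp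
      moreover have "R = 2 * x n + l * x n" by (simp add: R_def distrib_right)
      ultimately have "g / 2 < R" using xn g by linarith
      then obtain T where T: "finite T" "real (card T) \<le> C * (R / (g / 2)) powr s"
        "ball 0 R \<inter> measure_support M \<subseteq> (\<Union>t\<in>T. ball t (g / 2))"
        using H[rule_format, of "g / 2" R 0] g by (auto simp: measure_support_eq)
      have gap: "g * (real v - real u) \<le> x u - x v" if "n \<le> u" "u \<le> v" "v \<le> 2 * n" for u v
      proof -
        have "g * (real v - real u) \<le> l * real v powr (-l - 1) * (real v - real u)"
          unfolding g_def using that l_pos n
          by (intro mult_left_mono mult_right_mono powr_mono2') auto
        also have "\<dots> \<le> x u - x v"
          using powr_minus_diff_bounds(1)[of "real u" "real v" l] that l_pos n by (simp add: x_eq)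
        finally show ?thesis .
      qed
      have sep: "g \<le> dist (x u) (x v)" if "n \<le> u" "u < v" "v \<le> 2 * n" for u v
      proof -
        have "g * 1 \<le> g * (real v - real u)" using that g by (intro mult_left_mono) auto
        then show ?thesis using gap[of u v] that by (simp add: dist_real_def)
      qed
      have inj: "inj_on x {n..2 * n}"
        using sep g by (intro linorder_inj_onI) force+
      have "real n \<le> real (card (x ` {n..2 * n}))" by (simp add: card_image[OF inj])
      also have "card (x ` {n..2 * n}) \<le> card T"
      proof (rule assouad_cover_card_ge[OF T(1)])
        have "x k \<in> ball 0 R" if "n \<le> k" for k
        proof -
          have "0 < x k" "x k \<le> x n"
            using that n l_pos by (auto simp: x_eq intro: powr_mono2')
          moreover have "x n < R" using xn l_pos by (simp add: R_def algebra_simps add_pos_pos)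
          ultimately show ?thesis by (simp add: dist_real_def)
        qed
        then show "x ` {n..2 * n} \<subseteq> (\<Union>t\<in>T. ball t (g / 2))"
          using T(3) n by (fastforce simp: measure_support_eq)
        fix u v assume "u \<in> x ` {n..2 * n}" "v \<in> x ` {n..2 * n}" "u \<noteq> v"
        then obtain i j where ij: "u = x i" "v = x j" "i \<in> {n..2 * n}" "j \<in> {n..2 * n}" "i \<noteq> j"
          by blast
        then show "2 * (g / 2) \<le> dist u v"
          using sep[of i j] sep[of j i] by (cases "i < j") (auto simp: dist_commute)
      qed
      also have "real (card T) \<le> C * (R / (g / 2)) powr s" by (rule T(2))
      also have "R / (g / 2) = G * real n"
        using xn n l_pos by (simp add: gx R_def G_def powr_diff powr_minus powr_add field_simps)
      also have "(G * real n) powr s = G powr s * real n powr s"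
        using l_pos by (simp add: powr_mult)
      finally show "real n powr 1 \<le> C * G powr s * real n powr s" by simp
    qed
    then show "ereal 1 \<le> ereal s" by simp
  qed
  then show "1 \<le> assouad_dim (measure_support M)" by (simp add: one_ereal_def)
qed (rule assouad_dim_real_le_1)

end

section \<open>Geometric positions\<close>

locale geometric_positions = null_sequence_masses x p for x p :: "nat \<Rightarrow> real" +
  fixes l :: real
  assumes l_pos: "0 < l" and l_less_1: "l < 1"
    and x_eq: "\<And>n. n \<ge> 1 \<Longrightarrow> x n = l ^ n"
begin

lemma x_pos: "n \<ge> 1 \<Longrightarrow> 0 < x n"
  using l_pos by (simp add: x_eq)

lemma x_le_1: "n \<ge> 1 \<Longrightarrow> x n \<le> 1"
  using l_pos l_less_1 by (simp add: x_eq power_le_one)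

text \<open>
  Geometric points are isolated at their own scale: a ball around \<open>x n\<close> meets another point only if its
  radius exceeds a fixed fraction of \<open>x n\<close>. This is applied with either point in the role of \<open>x n\<close>.
\<close>

lemma gap_le_dist:
  assumes "n \<ge> 1" "k \<ge> 1" "n \<noteq> k"
  shows "(1 - l) * x n \<le> dist (x n) (x k)"
proof (cases "n < k")
  case True
  then have "l ^ k \<le> l ^ Suc n"
    using l_pos l_less_1 by (intro power_decreasing) auto
  then show ?thesis using assms by (simp add: x_eq dist_real_def algebra_simps)
next
  case False
  then have "l ^ n \<le> l ^ Suc k"
    using assms l_pos l_less_1 by (intro power_decreasing) auto
  moreover have "(1 - l) * l ^ n \<le> (1 - l) * l ^ k"
    using False l_pos l_less_1 by (intro mult_left_mono power_decreasing) auto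
  ultimately show ?thesis using assms by (simp add: x_eq dist_real_def algebra_simps)
qed

lemma ball_point_cases:
  assumes "y \<in> measure_support M" "k \<ge> 1" "x k \<in> ball y R"
  shows "x k = y \<or> (1 - l) * x k < R"
proof (cases "y = 0")
  case True
  have "(1 - l) * x k \<le> 1 * x k"
    using x_pos[OF assms(2)] l_pos by (intro mult_right_mono) auto
  moreover have "x k < R" using True assms by (simp add: dist_real_def)
  ultimately show ?thesis by linarith
next
  case False
  then obtain n where "n \<ge> 1" "y = x n" using assms(1) by (auto simp: measure_support_eq)
  then show ?thesis using gap_le_dist[of k n] assms by (cases "k = n") (auto simp: dist_commute)
qed

text \<open>
  By \<open>ball_point_cases\<close> the points of the support in \<open>ball y R\<close> other than the centre lie below
  \<open>R / (1 - l)\<close>. One ball of radius \<open>r\<close> around the origin covers those below \<open>r\<close>, and the number of the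
  remaining ones is logarithmic in \<open>R / r\<close>, hence at most a constant multiple of \<open>(R / r) powr s\<close> for
  every \<open>s > 0\<close>.
\<close>

theorem assouad_dim_geometric: "assouad_dim (measure_support M) = 0"
proof (rule antisym)
  define L where "L = - ln l"
  define D where "D = - ln (1 - l)"
  have L: "L > 0" and D: "D > 0" using l_pos l_less_1 by (auto simp: L_def D_def)
  have "assouad_dim (measure_support M) \<le> ereal s" if "s > 0" for s
  proof (rule assouad_dim_leI)
    show "3 + (1 / s + D) / L > 0" using L D that by (intro add_pos_pos divide_pos_pos) auto
    fix r R y :: real
    assume r: "0 < r" "r < R" and y: "y \<in> measure_support M"
    define K where "K = {k. k \<ge> 1 \<and> r \<le> x k \<and> (1 - l) * x k < R}"
    define J where "J = {k::nat. (- ln R - D) / L \<le> real k \<and> real k \<le> - ln r / L}"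
    have lnR: "ln r < ln R" using r by simp
    have "(- ln R - D) / L \<le> - ln r / L"
      using L D lnR by (intro divide_right_mono) auto
    then have J: "finite J" "real (card J) \<le> - ln r / L - (- ln R - D) / L + 1"
      unfolding J_def by (rule card_nats_in_real_interval)+
    have "K \<subseteq> J"
    proof
      fix k assume "k \<in> K"
      then have k: "k \<ge> 1" "r \<le> l ^ k" "(1 - l) * l ^ k < R" by (auto simp: K_def x_eq)
      have "ln r \<le> ln (l ^ k)" using k r l_pos by (subst ln_le_cancel_iff) auto
      moreover have "ln ((1 - l) * l ^ k) \<le> ln R"
        using k r l_pos l_less_1 by (subst ln_le_cancel_iff) auto
      ultimately have "ln r \<le> - (real k * L)" "- D - real k * L \<le> ln R"
        using l_pos l_less_1 by (simp_all add: ln_mult ln_realpow L_def D_def)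
      then show "k \<in> J" using L by (simp add: J_def field_simps)
    qed
    define T where "T = insert y (insert 0 (x ` K))"
    have "finite K" using \<open>K \<subseteq> J\<close> J(1) finite_subset by blast
    then have "card T \<le> Suc (Suc (card K))"
      using card_image_le[of K x] by (simp add: T_def card_insert_if)
    also have "card K \<le> card J" using \<open>K \<subseteq> J\<close> J(1) by (rule card_mono[rotated])
    finally have "real (card T) \<le> 2 + (- ln r / L - (- ln R - D) / L + 1)"
      using J(2) by linarith
    also have "\<dots> = 3 * 1 + (ln (R / r) + D * 1) / L"
      using L r by (simp add: ln_div field_simps)
    also have "\<dots> \<le> 3 * (R / r) powr s + ((R / r) powr s / s + D * (R / r) powr s) / L"
      using r that D L
      by (intro add_mono mult_left_mono divide_right_mono ln_powr_bound ge_one_powr_ge_zero) auto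
    also have "\<dots> = (3 + (1 / s + D) / L) * (R / r) powr s"
      using that L by (simp add: field_simps)
    finally have "real (card T) \<le> (3 + (1 / s + D) / L) * (R / r) powr s" .
    moreover have "ball y R \<inter> measure_support M \<subseteq> (\<Union>t\<in>T. ball t r)"
    proof
      fix z assume z: "z \<in> ball y R \<inter> measure_support M"
      show "z \<in> (\<Union>t\<in>T. ball t r)"
      proof (cases "z = 0")
        case False
        then obtain k where k: "k \<ge> 1" "z = x k" using z by (auto simp: measure_support_eq)
        show ?thesis
        proof (cases "x k < r")
          case True
          then have "z \<in> ball 0 r" using k x_pos[of k] by (simp add: dist_real_def)
          then show ?thesis by (auto simp: T_def)
        next
          case False
          then have "z = y \<or> k \<in> K"
            using ball_point_cases[OF y k(1), of R] z k by (auto simp: K_def)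
          then have "z \<in> T" using k by (auto simp: T_def)
          then show ?thesis using r by (intro UN_I[of z]) auto
        qed
      qed (use r in \<open>auto simp: T_def\<close>)
    qed
    ultimately show "\<exists>T. finite T \<and> real (card T) \<le> (3 + (1 / s + D) / L) * (R / r) powr s \<and>
        ball y R \<inter> measure_support M \<subseteq> (\<Union>t\<in>T. ball t r)"
      using \<open>finite K\<close> by (intro exI[of _ T]) (auto simp: T_def)
  qed (use that in auto)
  note le = this
  show "assouad_dim (measure_support M) \<le> 0"
  proof (rule dense_ge)
    fix e :: ereal assume "0 < e"
    then show "assouad_dim (measure_support M) \<le> e" using le by (cases e) auto
  qed
qed (rule assouad_dim_nonneg)

text \<open>
  The ball of radius \<open>(1 - l) * x n\<close> around \<open>x n\<close> contains only that atom, of mass \<open>n powr -w\<close>, whereas the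
  ball of radius \<open>x n\<close> contains the points \<open>x n, \<dots>, x (2 * n)\<close>, whose mass is larger by a factor of order
  \<open>n\<close>. A bounded number of halvings separates the two radii.
\<close>

theorem not_doubling_geometric_positions_power_weights:
  assumes w: "w > 1" and p_eq: "\<And>n. n \<ge> 1 \<Longrightarrow> p n = real n powr -w"
  shows "\<not> doubling_measure M"
proof
  assume "doubling_measure M"
  then obtain C where C: "C > 0" "\<And>R y. R > 0 \<Longrightarrow> y \<in> measure_support M \<Longrightarrow>
      measure M (ball y R) / measure M (ball y (R / 2)) \<le> C"
    unfolding doubling_measure_def by blast
  obtain j where "1 / (1 - l) < 2 ^ j" using real_arch_pow[of 2 "1 / (1 - l)"] by auto
  then have j: "1 / 2 ^ j \<le> 1 - l" using l_less_1 by (simp add: field_simps)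
  obtain n :: nat where n: "real n > max 1 (C ^ j * 2 powr w)"
    using reals_Archimedean2 by blast
  then have n1: "n \<ge> 1" by simp
  have xn: "x n > 0" using n1 by (rule x_pos)
  have "real n * (2 powr -w * real n powr -w) \<le> real (n + 1) * (2 powr -w * real n powr -w)"
    by (intro mult_right_mono) auto
  also have "\<dots> \<le> infsum p {n..n + n}"
    using block_sum_powr_ge[OF n1 order_refl, of w] w n1 by (simp add: p_eq)
  finally have "scale * (real n * (2 powr -w * real n powr -w)) \<le> scale * infsum p {n..n + n}"
    using scale_pos by (intro mult_left_mono) auto
  also have "\<dots> \<le> measure M (ball (x n) (x n))"
  proof (rule infsum_le_measure)
    fix k assume "k \<in> {n..n + n}"
    then have "k \<ge> 1" "x k \<le> x n" "0 < x k"
      using n1 l_pos l_less_1 by (auto simp: x_eq intro!: power_decreasing)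
    then show "x k \<in> ball (x n) (x n)" by (simp add: dist_real_def)
  qed (use n1 in auto)
  also have "\<dots> \<le> C ^ j * measure M (ball (x n) (x n / 2 ^ j))"
    using C xn n1 finite_measure_axioms
    by (intro measure_ball_le_iterated_doubling) (auto simp: measure_support_eq)
  also have "\<dots> \<le> C ^ j * (scale * infsum p {n})"
  proof (intro mult_left_mono measure_le_infsum)
    fix k assume k: "k \<ge> 1" "x k \<in> ball (x n) (x n / 2 ^ j)"
    have "x n / 2 ^ j \<le> (1 - l) * x n" using mult_right_mono[OF j, of "x n"] xn by simp
    then show "k \<in> {n}" using gap_le_dist[OF n1 k(1)] k by fastforce
  qed (use C n1 in auto)
  also have "\<dots> = C ^ j * (scale * real n powr -w)" using n1 by (simp add: p_eq)
  finally have "(scale * real n powr -w) * (real n * 2 powr -w) \<le> (scale * real n powr -w) * C ^ j"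
    by (simp add: mult_ac)
  then have "real n * 2 powr -w \<le> C ^ j"
    by (rule mult_left_le_imp_le) (use scale_pos n1 in auto)
  then have "real n \<le> C ^ j * 2 powr w" by (simp add: powr_minus field_simps)
  with n show False by simp
qed

end

section \<open>Geometric positions and geometric weights\<close>

locale geometric_masses = geometric_positions x p l for x p :: "nat \<Rightarrow> real" and l +
  fixes w :: real
  assumes w_pos: "0 < w" and w_less_1: "w < 1"
    and p_eq: "\<And>n. n \<ge> 1 \<Longrightarrow> p n = w ^ n"
begin

text \<open>The exponent with \<open>p n = x n powr t\<close>.\<close>

definition t :: real where
  "t = ln w / ln l"

lemma t_pos: "t > 0"
  using l_pos l_less_1 w_pos w_less_1 by (simp add: t_def divide_neg_neg)

lemma pow_powr_t: "(l ^ n) powr t = w ^ n"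
proof -
  have "l powr t = w" using l_pos l_less_1 w_pos by (simp add: t_def powr_def)
  moreover have "(l powr real n) powr t = (l powr t) powr real n"
    by (simp add: powr_powr mult.commute)
  ultimately show ?thesis using l_pos w_pos by (simp add: powr_realpow)
qed

text \<open>
  Weights decaying geometrically make a single atom sufficient: the largest point below \<open>r\<close> exceeds or
  equals \<open>l * r\<close>.
\<close>

lemma mass_near_origin_ge:
  assumes "A \<in> sets borel" "0 < r" "r \<le> 1"
    and "\<And>k. k \<ge> 1 \<Longrightarrow> x k < r \<Longrightarrow> x k \<in> A"
  shows "scale * w * r powr t \<le> measure M A"
proof -
  define m where "m = (LEAST k. l ^ k < r)"
  have "\<exists>k. l ^ k < r" using real_arch_pow_inv assms l_less_1 by blast
  then have m: "l ^ m < r" unfolding m_def by (rule LeastI_ex)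
  have "m \<noteq> 0" using m assms by (intro notI) auto
  then obtain k where k: "m = Suc k" using not0_implies_Suc by blast
  then have "r \<le> l ^ k" using not_less_Least[of k "\<lambda>k. l ^ k < r"] by (auto simp: m_def)
  then have "r powr t \<le> w ^ k"
    using assms t_pos by (subst pow_powr_t[symmetric]) (intro powr_mono2, auto)
  then have "scale * w * r powr t \<le> scale * w * w ^ k"
    using scale_pos w_pos by (intro mult_left_mono) auto
  also have "\<dots> = scale * infsum p {m}" using k by (simp add: p_eq)
  also have "\<dots> \<le> measure M A"
  proof (rule infsum_le_measure)
    show "x i \<in> A" if "i \<in> {m}" for i
      using that assms(4)[of m] m \<open>m \<noteq> 0\<close> by (simp add: x_eq)
  qed (use assms \<open>m \<noteq> 0\<close> in auto)
  finally show ?thesis .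
qed

lemma mass_near_origin_le:
  assumes "A \<in> sets borel" "0 < R" "\<And>k. k \<ge> 1 \<Longrightarrow> x k \<in> A \<Longrightarrow> x k < R"
  shows "measure M A \<le> scale / (1 - w) * R powr t"
proof -
  define N where "N = (LEAST k. k \<ge> 1 \<and> l ^ k < R)"
  obtain k where k: "l ^ k < R" using real_arch_pow_inv assms l_less_1 by blast
  have "l ^ Suc k \<le> l ^ k" using l_pos l_less_1 by (intro power_decreasing) auto
  with k have "\<exists>k\<ge>1. l ^ k < R" by (intro exI[of _ "Suc k"]) auto
  then have N: "N \<ge> 1" "l ^ N < R" unfolding N_def by (metis (mono_tags, lifting) LeastI_ex)+
  have "measure M A \<le> scale * infsum p {N..}"
  proof (rule measure_le_infsum)
    fix k assume "k \<ge> 1" "x k \<in> A"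
    then show "k \<in> {N..}"
      using assms(3)[of k] by (auto simp: N_def x_eq intro!: Least_le)
  qed (use assms N in auto)
  also have "infsum p {N..} = infsum (\<lambda>k. w ^ k) {N..}"
    using N by (intro infsum_cong) (auto simp: p_eq)
  also have "\<dots> = (l ^ N) powr t / (1 - w)"
    using w_pos w_less_1 by (simp add: infsum_geometric_tail pow_powr_t)
  also have "scale * \<dots> \<le> scale * (R powr t / (1 - w))"
    using scale_pos N l_pos t_pos w_less_1
    by (intro mult_left_mono divide_right_mono powr_mono2) auto
  finally show ?thesis by simp
qed

lemma measure_ball_ge:
  assumes "y \<in> measure_support M" "0 < r" "r \<le> 1"
  shows "scale * w * r powr t \<le> measure M (ball y r)"
proof -
  have y: "0 \<le> y" "y \<le> 1"
    using assms x_pos x_le_1 by (auto simp: measure_support_eq less_imp_le)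
  show ?thesis
  proof (cases "y \<le> r")
    case True
    show ?thesis
    proof (rule mass_near_origin_ge)
      fix k assume "k \<ge> 1" "x k < r"
      then show "x k \<in> ball y r" using x_pos[of k] True y by (simp add: dist_real_def abs_less_iff)
    qed (use assms in auto)
  next
    case False
    then obtain n where n: "n \<ge> 1" "y = x n" using assms by (auto simp: measure_support_eq)
    have "scale * w * r powr t \<le> scale * 1 * y powr t"
      using scale_pos w_pos w_less_1 t_pos False assms
      by (intro mult_mono mult_left_mono powr_mono2) auto
    also have "\<dots> = scale * infsum p {n}" using n by (simp add: x_eq p_eq pow_powr_t)
    also have "\<dots> \<le> measure M (ball y r)"
      using n assms by (intro infsum_le_measure) auto
    finally show ?thesis .
  qed
qed

lemma measure_ball_0_le:
  assumes "0 < r"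
  shows "measure M (ball 0 r) \<le> scale / (1 - w) * r powr t"
proof (rule mass_near_origin_le)
  fix k assume "k \<ge> 1" "x k \<in> ball 0 r"
  then show "x k < r" using x_pos[of k] by (simp add: dist_real_def)
qed (use assms in auto)

theorem SUP_upper_local_dim_geometric:
  "(SUP y\<in>measure_support M. upper_local_dim y M) = ereal t"
proof (rule SUP_upper_local_dim)
  show "upper_local_dim 0 M = ereal t"
    using scale_pos w_pos measure_ball_ge measure_ball_0_le
    by (intro upper_local_dim_eqI[of "scale * w" t _ _ "scale / (1 - w)"]) (auto simp: measure_support_eq)
qed (use t_pos in auto)

text \<open>
  As long as \<open>R \<le> (1 - l) * y\<close> both balls carry the mass of their centre only. Otherwise \<open>y\<close> is at most of
  the order of \<open>R\<close>, so the large ball has mass at most of order \<open>R powr t\<close>, while the small one has mass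
  at least of order \<open>r powr t\<close> if \<open>r < 1\<close> and a fixed part of the total mass if \<open>r \<ge> 1\<close>.
\<close>

theorem upper_reg_dim_geometric: "upper_reg_dim M = ereal t"
proof (rule antisym)
  show "ereal t \<le> upper_reg_dim M"
    using scale_pos w_pos measure_ball_ge measure_ball_0_le
    by (intro upper_reg_dim_ge_of_power_bounds[of 0 _ "scale * w" t "scale / (1 - w)"])
       (auto simp: measure_support_eq)
  define b where "b = scale / (1 - w) / (1 - l) powr t"
  have b: "b > 0" using scale_pos w_less_1 l_less_1 by (simp add: b_def)
  have cw: "scale * w > 0" using scale_pos w_pos by simp
  define C where "C = 1 + 1 / (scale * w) + b / (scale * w)"
  have C: "1 \<le> C" "1 / (scale * w) \<le> C" "b / (scale * w) \<le> C"
    using b cw unfolding C_def by (auto intro!: add_nonneg_nonneg)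
  show "upper_reg_dim M \<le> ereal t"
  proof (rule upper_reg_dim_leI)
    fix r R y :: real
    assume r: "0 < r" "r < R" and y: "y \<in> measure_support M"
    have Rr: "1 \<le> (R / r) powr t" using r t_pos by (intro ge_one_powr_ge_zero) auto
    consider "R \<le> (1 - l) * y" | "r \<ge> 1" | "(1 - l) * y < R" "r < 1" by linarith
    then have "\<exists>q\<le>C. measure M (ball y R) \<le> q * (R / r) powr t * measure M (ball y r)"
    proof cases
      case 1
      then have "y \<noteq> 0" using r by auto
      then obtain n where n: "n \<ge> 1" "y = x n" using y by (auto simp: measure_support_eq)
      have "measure M (ball y R) \<le> scale * infsum p {n}"
      proof (rule measure_le_infsum)
        fix k assume k: "k \<ge> 1" "x k \<in> ball y R"
        then show "k \<in> {n}" using gap_le_dist[OF n(1) k(1)] 1 n by fastforce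
      qed (use n in auto)
      also have "\<dots> \<le> measure M (ball y r)"
        using n r by (intro infsum_le_measure) auto
      also have "\<dots> \<le> 1 * (R / r) powr t * measure M (ball y r)"
        using mult_right_mono[OF Rr, of "measure M (ball y r)"] by simp
      finally show ?thesis using C by blast
    next
      case 2
      have "scale * w * 1 powr t \<le> measure M (ball y 1)" using y by (intro measure_ball_ge) auto
      also have "\<dots> \<le> measure M (ball y r)" using 2 by (intro finite_measure_mono) auto
      finally have "1 \<le> 1 / (scale * w) * measure M (ball y r)" using cw by (simp add: field_simps)
      also have "\<dots> \<le> 1 / (scale * w) * measure M (ball y r) * (R / r) powr t"
        using mult_left_mono[OF Rr, of "1 / (scale * w) * measure M (ball y r)"] cw by simp
      finally have "measure M (ball y R) \<le> 1 / (scale * w) * measure M (ball y r) * (R / r) powr t"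
        using prob_le_1 by (rule order_trans[rotated])
      then have "measure M (ball y R) \<le> 1 / (scale * w) * (R / r) powr t * measure M (ball y r)"
        by (simp only: mult_ac)
      then show ?thesis using C by blast
    next
      case 3
      have "measure M (ball y R) \<le> scale / (1 - w) * (R / (1 - l)) powr t"
      proof (rule mass_near_origin_le)
        fix k assume "k \<ge> 1" "x k \<in> ball y R"
        then have "(1 - l) * x k < R" using ball_point_cases[OF y] 3 by blast
        then show "x k < R / (1 - l)" using l_less_1 by (simp add: field_simps)
      qed (use r l_less_1 in auto)
      also have "\<dots> = b / (scale * w) * (R / r) powr t * (scale * w * r powr t)"
        using scale_pos w_pos r l_less_1 by (simp add: b_def powr_divide)
      also have "\<dots> \<le> b / (scale * w) * (R / r) powr t * measure M (ball y r)"
        using b cw y r 3 by (intro mult_left_mono measure_ball_ge) auto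
      finally show ?thesis using C by blast
    qed
    then obtain q where "q \<le> C" "measure M (ball y R) \<le> q * (R / r) powr t * measure M (ball y r)"
      by blast
    moreover have "q * (R / r) powr t * measure M (ball y r) \<le> C * (R / r) powr t * measure M (ball y r)"
      using \<open>q \<le> C\<close> by (intro mult_right_mono) auto
    ultimately show "measure M (ball y R) \<le> C * (R / r) powr t * measure M (ball y r)"
      by linarith
  qed (use t_pos C in auto)
qed

end

section \<open>Polynomial positions and geometric weights\<close>

text \<open>
  Compare the balls of radii \<open>x n\<close> and \<open>2 * x n\<close> around the origin. The first index in the large one is about
  \<open>q * n\<close> with \<open>q < 1\<close>, and geometric weights turn this into a ratio of masses of order
  \<open>w powr ((q - 1) * n)\<close>, which is unbounded.
\<close>

theorem (in null_sequence_masses) not_doubling_power_positions_geometric_weights: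
  assumes l: "l > 0" and w: "0 < w" "w < 1"
    and x_eq: "\<And>n. n \<ge> 1 \<Longrightarrow> x n = real n powr -l"
    and p_eq: "\<And>n. n \<ge> 1 \<Longrightarrow> p n = w ^ n"
  shows "\<not> doubling_measure M"
proof
  assume "doubling_measure M"
  then obtain C where C: "\<And>R y. R > 0 \<Longrightarrow> y \<in> measure_support M \<Longrightarrow>
      measure M (ball y R) / measure M (ball y (R / 2)) \<le> C"
    unfolding doubling_measure_def by blast
  \<comment> \<open>\<open>x (q * n) = 2 * x n\<close> if \<open>x\<close> is extended to real indices\<close>
  define q :: real where "q = 2 powr (-1 / l)"
  have q: "0 < q" "q < 1" using l powr_less_mono[of "-1 / l" 0 2] by (simp_all add: q_def)
  have ql: "q powr -l = 2" using l by (simp add: q_def powr_powr)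
  have "1 < w powr (q - 1)"
    using powr_less_mono2_neg[of "q - 1" w 1] q w by simp
  then obtain n where "C / ((1 - w) * w) < (w powr (q - 1)) ^ n" using real_arch_pow by blast
  also have "(w powr (q - 1)) ^ n \<le> (w powr (q - 1)) ^ Suc n"
    using \<open>1 < w powr (q - 1)\<close> by (intro power_increasing) auto
  finally obtain n where n: "n \<ge> 1" "C / ((1 - w) * w) < (w powr (q - 1)) ^ n"
    by (metis One_nat_def Suc_le_mono le0)
  define m where "m = nat \<lfloor>q * real n\<rfloor> + 1"
  have "q * real n > 0" using q n by simp
  then have m: "m \<ge> 1" "q * real n < real m" "real m \<le> q * real n + 1"
    unfolding m_def by linarith+
  have xn: "x n > 0" using n by (simp add: x_eq)
  have xm: "x m < 2 * x n"
    using powr_less_mono2_neg[OF _ _ m(2), of "-l"] l q n m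
    by (simp add: x_eq powr_mult ql)
  have supp: "0 \<in> measure_support M" by (simp add: measure_support_eq)
  have mpos: "measure M (ball 0 (x n)) > 0"
    using xn supp finite_measure_axioms by (intro measure_ball_support_pos)
  have "w powr (q * real n + 1) \<le> w powr real m"
    using w m by (intro powr_mono') auto
  then have "scale * (w * w powr (q * real n)) \<le> scale * infsum p {m}"
    using m w scale_pos by (simp add: p_eq powr_realpow powr_add mult.commute)
  also have "\<dots> \<le> measure M (ball 0 (2 * x n))"
    using m xm by (intro infsum_le_measure) (auto simp: dist_real_def x_eq)
  also have "\<dots> \<le> C * measure M (ball 0 (x n))"
    using C[of "2 * x n" 0] supp xn mpos by (simp add: divide_le_eq)
  finally have le: "scale * (w * w powr (q * real n)) \<le> C * measure M (ball 0 (x n))" .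
  moreover have "0 < scale * (w * w powr (q * real n))" using scale_pos w by simp
  ultimately have "C > 0" using mpos by (meson less_le_trans zero_less_mult_pos2)
  note le
  also have "C * measure M (ball 0 (x n)) \<le> C * (scale * infsum p {n..})"
  proof (intro mult_left_mono measure_le_infsum)
    fix k assume k: "k \<ge> 1" "x k \<in> ball 0 (x n)"
    then have "real k powr -l < real n powr -l" using n by (simp add: dist_real_def x_eq)
    then show "k \<in> {n..}" using k n l by (simp add: powr_minus_less_iff)
  qed (use \<open>C > 0\<close> n in auto)
  also have "infsum p {n..} = infsum (\<lambda>k. w ^ k) {n..}"
    using n by (intro infsum_cong) (auto simp: p_eq)
  also have "\<dots> = w powr real n / (1 - w)"
    using w by (simp add: infsum_geometric_tail powr_realpow)
  finally have "scale * (w * w powr (q * real n)) \<le> scale * (C * (w powr real n / (1 - w)))"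
    by (simp only: mult.left_commute)
  then have "w * w powr (q * real n) \<le> C * (w powr real n / (1 - w))"
    by (rule mult_left_le_imp_le) (rule scale_pos)
  moreover have "(w powr (q - 1)) ^ n = w powr (q * real n) / w powr real n"
  proof -
    have "(w powr (q - 1)) ^ n = (w powr (q - 1)) powr real n"
      using w by (simp only: powr_realpow powr_gt_zero)
    also have "\<dots> = w powr (q * real n - real n)"
      by (simp only: powr_powr left_diff_distrib mult_1)
    finally show ?thesis by (simp only: powr_diff)
  qed
  ultimately have "(w powr (q - 1)) ^ n * w * w powr real n \<le> C / (1 - w) * w powr real n"
    using w by (simp add: mult_ac)
  then have "(w powr (q - 1)) ^ n * w \<le> C / (1 - w)"
    by (rule mult_right_le_imp_le) (use w in simp)
  then have "(w powr (q - 1)) ^ n \<le> C / ((1 - w) * w)"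
    using w by (simp add: pos_le_divide_eq flip: divide_divide_eq_left)
  with n show False by simp
qed

section \<open>The dimensions in the four cases\<close>

theorem theorem2p7:
  fixes x p :: "nat \<Rightarrow> real" and M :: "real measure"
  assumes x_range: "\<And>n. n \<ge> 1 \<Longrightarrow> x n \<in> {0..1}"
    and x_decreasing: "\<And>n. n \<ge> 1 \<Longrightarrow> x (Suc n) \<le> x n"
    and x_lim: "x \<longlonglongrightarrow> 0"
    and p_pos: "\<And>n. n \<ge> 1 \<Longrightarrow> p n > 0"
    and p_decreasing: "\<And>n. n \<ge> 1 \<Longrightarrow> p (Suc n) \<le> p n"
    and p_lim: "p \<longlonglongrightarrow> 0"
    and p_summable: "summable (\<lambda>n. p (Suc n))"
    and M: "M = normalized_point_masses x p"
  shows
    "(\<forall>(l :: real) (w :: real). l > 0 \<longrightarrow> w > 1 \<longrightarrow>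
        (\<forall>n\<ge>1. x n = real n powr (-l)) \<longrightarrow> (\<forall>n\<ge>1. p n = real n powr (-w)) \<longrightarrow>
        upper_reg_dim M = ereal (max 1 ((w - 1) / l)) \<and>
        ereal (max 1 ((w - 1) / l)) =
          max (assouad_dim (measure_support M)) (SUP y\<in>measure_support M. upper_local_dim y M))
     \<and>
     (\<forall>(l :: real) (w :: real). 0 < l \<longrightarrow> l < 1 \<longrightarrow> 0 < w \<longrightarrow> w < 1 \<longrightarrow>
        (\<forall>n\<ge>1. x n = l ^ n) \<longrightarrow> (\<forall>n\<ge>1. p n = w ^ n) \<longrightarrow>
        upper_reg_dim M = ereal (ln w / ln l) \<and>
        ereal (ln w / ln l) = (SUP y\<in>measure_support M. upper_local_dim y M) \<and>
        (SUP y\<in>measure_support M. upper_local_dim y M) > 0 \<and>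
        assouad_dim (measure_support M) = 0)
     \<and>
     (\<forall>(l :: real) (w :: real).
        (l > 0 \<and> 0 < w \<and> w < 1 \<and>
           (\<forall>n\<ge>1. x n = real n powr (-l)) \<and> (\<forall>n\<ge>1. p n = w ^ n)) \<or>
        (0 < l \<and> l < 1 \<and> w > 1 \<and>
           (\<forall>n\<ge>1. x n = l ^ n) \<and> (\<forall>n\<ge>1. p n = real n powr (-w))) \<longrightarrow>
        \<not> doubling_measure M \<and> upper_reg_dim M = \<infinity>)"
proof (intro conjI)
  note base = x_lim p_pos p_summable
  have masses: "null_sequence_masses x p"
    using base by unfold_locales
  show "\<forall>l w. l > 0 \<longrightarrow> w > 1 \<longrightarrow>
      (\<forall>n\<ge>1. x n = real n powr (-l)) \<longrightarrow> (\<forall>n\<ge>1. p n = real n powr (-w)) \<longrightarrow>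
      upper_reg_dim M = ereal (max 1 ((w - 1) / l)) \<and>
      ereal (max 1 ((w - 1) / l)) =
        max (assouad_dim (measure_support M)) (SUP y\<in>measure_support M. upper_local_dim y M)"
  proof (intro allI impI)
    fix l w :: real
    assume lw: "l > 0" "w > 1" "\<forall>n\<ge>1. x n = real n powr (-l)" "\<forall>n\<ge>1. p n = real n powr (-w)"
    interpret power_law_masses x p l w
      using masses lw by (intro power_law_masses.intro power_law_masses_axioms.intro) auto
    show "upper_reg_dim M = ereal (max 1 ((w - 1) / l)) \<and>
      ereal (max 1 ((w - 1) / l)) =
        max (assouad_dim (measure_support M)) (SUP y\<in>measure_support M. upper_local_dim y M)"
      using upper_reg_dim_power_law assouad_dim_power_law SUP_upper_local_dim_eq
      by (simp add: assms(8) t_def one_ereal_def)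
  qed
  show "\<forall>l w. 0 < l \<longrightarrow> l < 1 \<longrightarrow> 0 < w \<longrightarrow> w < 1 \<longrightarrow>
      (\<forall>n\<ge>1. x n = l ^ n) \<longrightarrow> (\<forall>n\<ge>1. p n = w ^ n) \<longrightarrow>
      upper_reg_dim M = ereal (ln w / ln l) \<and>
      ereal (ln w / ln l) = (SUP y\<in>measure_support M. upper_local_dim y M) \<and>
      (SUP y\<in>measure_support M. upper_local_dim y M) > 0 \<and>
      assouad_dim (measure_support M) = 0"
  proof (intro allI impI)
    fix l w :: real
    assume lw: "0 < l" "l < 1" "0 < w" "w < 1" "\<forall>n\<ge>1. x n = l ^ n" "\<forall>n\<ge>1. p n = w ^ n"
    interpret geometric_masses x p l w
      using masses lw
      by (intro geometric_masses.intro geometric_positions.intro geometric_positions_axioms.intro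
          geometric_masses_axioms.intro) auto
    show "upper_reg_dim M = ereal (ln w / ln l) \<and>
      ereal (ln w / ln l) = (SUP y\<in>measure_support M. upper_local_dim y M) \<and>
      (SUP y\<in>measure_support M. upper_local_dim y M) > 0 \<and>
      assouad_dim (measure_support M) = 0"
      using upper_reg_dim_geometric SUP_upper_local_dim_geometric assouad_dim_geometric t_pos
      by (simp add: assms(8) t_def)
  qed
  show "\<forall>l w.
      (l > 0 \<and> 0 < w \<and> w < 1 \<and>
         (\<forall>n\<ge>1. x n = real n powr (-l)) \<and> (\<forall>n\<ge>1. p n = w ^ n)) \<or>
      (0 < l \<and> l < 1 \<and> w > 1 \<and>
         (\<forall>n\<ge>1. x n = l ^ n) \<and> (\<forall>n\<ge>1. p n = real n powr (-w))) \<longrightarrow>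
      \<not> doubling_measure M \<and> upper_reg_dim M = \<infinity>"
  proof (intro allI impI, elim disjE)
    fix l w :: real
    assume "l > 0 \<and> 0 < w \<and> w < 1 \<and>
         (\<forall>n\<ge>1. x n = real n powr (-l)) \<and> (\<forall>n\<ge>1. p n = w ^ n)"
    then have "\<not> doubling_measure M"
      unfolding assms(8)
      by (intro null_sequence_masses.not_doubling_power_positions_geometric_weights[OF masses, of l w])
         auto
    then show "\<not> doubling_measure M \<and> upper_reg_dim M = \<infinity>"
      by (simp add: upper_reg_dim_eq_infinity)
  next
    fix l w :: real
    assume lw: "0 < l \<and> l < 1 \<and> w > 1 \<and>
         (\<forall>n\<ge>1. x n = l ^ n) \<and> (\<forall>n\<ge>1. p n = real n powr (-w))"
    interpret geometric_positions x p l
      using masses lw by (intro geometric_positions.intro geometric_positions_axioms.intro) auto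
    have "\<not> doubling_measure M"
      unfolding assms(8)
      using lw by (intro not_doubling_geometric_positions_power_weights[of w]) auto
    then show "\<not> doubling_measure M \<and> upper_reg_dim M = \<infinity>"
      by (simp add: upper_reg_dim_eq_infinity)
  qed
qed

end
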